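(* Let $\Lambda$ be a finite set, $\mathcal H_\Lambda=\bigotimes_{x\in\Lambda}\mathcal H_x$ with each $\mathcal H_x$ finite dimensional, $\rho_\Lambda\in\mathcal S_\Lambda$, and $\sigma_\Lambda=\bigotimes_{x\in\Lambda}\sigma_x$ a full-rank product state. Then $$D(\rho_\Lambda\|\sigma_\Lambda)\le\sum_{x\in\Lambda}D_x(\rho_\Lambda\|\sigma_\Lambda).$$
   Context: $D(\rho\|\sigma)=\operatorname{tr}[\rho(\log\rho-\log\sigma)]$. For $x\in\Lambda$ with $x^c=\Lambda\setminus\{x\}$, $D_x(\rho_\Lambda\|\sigma_\Lambda):=D(\rho_\Lambda\|\sigma_\Lambda)-D(\rho_{x^c}\|\sigma_{x^c})$, where $\rho_{x^c},\sigma_{x^c}$ are the reduced states on $x^c$. *)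

theory Defs
  imports Complex_Main "HOL-Library.FuncSet"
begin

text \<open>
  Finite-dimensional operators are represented as kernels on a finite index
  set I (an orthonormal basis of the Hilbert space): an operator is a function
  A :: 'i => 'i => complex, only its values on I x I being relevant.
\<close>

type_synonym 'i op = "'i \<Rightarrow> 'i \<Rightarrow> complex"

definition op_trace :: "'i set \<Rightarrow> 'i op \<Rightarrow> complex" where
  "op_trace I A = (\<Sum>i\<in>I. A i i)"

definition op_mult :: "'i set \<Rightarrow> 'i op \<Rightarrow> 'i op \<Rightarrow> 'i op" where
  "op_mult I A B = (\<lambda>i j. \<Sum>k\<in>I. A i k * B k j)"

definition op_hermitian :: "'i set \<Rightarrow> 'i op \<Rightarrow> bool" where
  "op_hermitian I A \<longleftrightarrow> (\<forall>i\<in>I. \<forall>j\<in>I. A j i = cnj (A i j))"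

definition quad_form :: "'i set \<Rightarrow> 'i op \<Rightarrow> ('i \<Rightarrow> complex) \<Rightarrow> complex" where
  "quad_form I A \<psi> = (\<Sum>i\<in>I. \<Sum>j\<in>I. cnj (\<psi> i) * A i j * \<psi> j)"

definition op_psd :: "'i set \<Rightarrow> 'i op \<Rightarrow> bool" where
  "op_psd I A \<longleftrightarrow> op_hermitian I A \<and> (\<forall>\<psi>. 0 \<le> Re (quad_form I A \<psi>))"

definition op_pd :: "'i set \<Rightarrow> 'i op \<Rightarrow> bool" where
  "op_pd I A \<longleftrightarrow> op_hermitian I A \<and>
     (\<forall>\<psi>. (\<exists>i\<in>I. \<psi> i \<noteq> 0) \<longrightarrow> 0 < Re (quad_form I A \<psi>))"

definition is_state :: "'i set \<Rightarrow> 'i op \<Rightarrow> bool" where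
  "is_state I \<rho> \<longleftrightarrow> op_psd I \<rho> \<and> op_trace I \<rho> = 1"

definition is_full_rank_state :: "'i set \<Rightarrow> 'i op \<Rightarrow> bool" where
  "is_full_rank_state I \<rho> \<longleftrightarrow> op_pd I \<rho> \<and> op_trace I \<rho> = 1"

definition spec_dec :: "'i set \<Rightarrow> 'i op \<Rightarrow> ('i \<Rightarrow> 'i \<Rightarrow> complex) \<Rightarrow> ('i \<Rightarrow> real) \<Rightarrow> bool" where
  "spec_dec I A v lam \<longleftrightarrow>
     (\<forall>k\<in>I. \<forall>l\<in>I. (\<Sum>i\<in>I. cnj (v k i) * v l i) = (if k = l then 1 else 0)) \<and>
     (\<forall>i\<in>I. \<forall>j\<in>I. A i j = (\<Sum>k\<in>I. complex_of_real (lam k) * v k i * cnj (v k j)))"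

definition op_fun :: "'i set \<Rightarrow> (real \<Rightarrow> real) \<Rightarrow> 'i op \<Rightarrow> 'i op" where
  "op_fun I f A =
    (let (v, lam) = (SOME (v, lam). spec_dec I A v lam) in
      (\<lambda>i j. if i \<in> I \<and> j \<in> I
              then (\<Sum>k\<in>I. complex_of_real (f (lam k)) * v k i * cnj (v k j)) else 0))"

text \<open>Logarithm on the support (convention 0 log 0 = 0).\<close>
definition log0 :: "real \<Rightarrow> real" where
  "log0 t = (if t > 0 then ln t else 0)"

text \<open>Umegaki relative entropy D(rho||sigma) = tr[rho (log rho - log sigma)]
  (used only for full-rank sigma).\<close>
definition rel_ent :: "'i set \<Rightarrow> 'i op \<Rightarrow> 'i op \<Rightarrow> real" where
  "rel_ent I \<rho> \<sigma> =
     Re (op_trace I (op_mult I \<rho> (\<lambda>i j. op_fun I log0 \<rho> i j - op_fun I log0 \<sigma> i j)))"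

text \<open>Tensor-product structure: basis of H_Lambda = configurations
  c : Lambda -> nat with c x < d x, where d x = dim H_x.\<close>
definition confs :: "'s set \<Rightarrow> ('s \<Rightarrow> nat) \<Rightarrow> ('s \<Rightarrow> nat) set" where
  "confs \<Lambda> d = PiE \<Lambda> (\<lambda>x. {..<d x})"

definition merge_conf :: "'s set \<Rightarrow> ('s \<Rightarrow> nat) \<Rightarrow> ('s \<Rightarrow> nat) \<Rightarrow> ('s \<Rightarrow> nat)" where
  "merge_conf A a c = (\<lambda>x. if x \<in> A then a x else c x)"

definition ptrace :: "'s set \<Rightarrow> ('s \<Rightarrow> nat) \<Rightarrow> 's set \<Rightarrow> ('s \<Rightarrow> nat) op \<Rightarrow> ('s \<Rightarrow> nat) op" where
  "ptrace \<Lambda> d B \<rho> = (\<lambda>a b. \<Sum>c\<in>confs B d.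
      \<rho> (merge_conf (\<Lambda> - B) a c) (merge_conf (\<Lambda> - B) b c))"

definition tensor_op :: "'s set \<Rightarrow> ('s \<Rightarrow> nat op) \<Rightarrow> ('s \<Rightarrow> nat) op" where
  "tensor_op \<Lambda> sig = (\<lambda>a b. \<Prod>x\<in>\<Lambda>. sig x (a x) (b x))"

definition rel_ent_site :: "'s set \<Rightarrow> ('s \<Rightarrow> nat) \<Rightarrow> 's \<Rightarrow> ('s \<Rightarrow> nat) op \<Rightarrow> ('s \<Rightarrow> nat) op \<Rightarrow> real" where
  "rel_ent_site \<Lambda> d x \<rho> \<sigma> =
     rel_ent (confs \<Lambda> d) \<rho> \<sigma> -
     rel_ent (confs (\<Lambda> - {x}) d) (ptrace \<Lambda> d {x} \<rho>) (ptrace \<Lambda> d {x} \<sigma>)"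

end

theory Submission
  imports Defs "Jordan_Normal_Form.Schur_Decomposition"
begin

text \<open>
  For a product state \<open>\<sigma>\<close> the logarithm of \<open>\<sigma>\<close> is a sum of one-site terms, so all terms involving
  \<open>\<sigma>\<close> cancel and the claim becomes \<open>\<Sum>x. (S(\<Lambda>) - S(\<Lambda> - x)) \<le> S(\<Lambda>)\<close> for the von Neumann entropies of
  the reduced states of \<open>\<rho>\<close>. Adding the sites one at a time, this telescopes from strong
  subadditivity, \<open>S(\<Lambda>) - S(\<Lambda> - x) \<le> S(A \<union> x) - S(A)\<close>.

  Strong subadditivity is monotonicity of the relative entropy under partial trace, for the pair
  \<open>\<rho>\<close> and \<open>\<rho>_S \<otimes> 1\<close>. With eigenvalues \<open>p_k\<close> of \<open>\<rho>\<close>, \<open>q_l\<close> of \<open>\<sigma>\<close> and overlaps \<open>u_kl\<close> of the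
  eigenvectors, the function \<open>F(s) = \<Sum>kl. |u_kl|^2 p_k ln (s p_k + q_l)\<close> has derivative
  \<open>\<Sum>kl. |u_kl|^2 p_k^2 / (s p_k + q_l) = sup_X (2 Re tr(\<rho> X) - s tr(\<rho> X\<^sup>* X) - tr(\<sigma> X X\<^sup>*))\<close>,
  which can only decrease when \<open>X\<close> is restricted to operators of the form \<open>Y \<otimes> 1\<close>. Integrating from
  \<open>s = 0\<close> to \<open>s = \<infinity>\<close> gives the monotonicity.
\<close>

section \<open>Spectral decompositions\<close>

lemma sum_diag_mult_mat:
  fixes A :: "'a :: comm_ring_1 mat"
  assumes "A \<in> carrier_mat n n" "B \<in> carrier_mat n n"
  shows "(\<Sum>i<n. (A * B) $$ (i,i)) = (\<Sum>i<n. \<Sum>j<n. A $$ (i,j) * B $$ (j,i))"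
  using assms by (intro sum.cong refl) (simp add: scalar_prod_def lessThan_atLeast0)

lemma similar_mat_wit_sum_diag:
  fixes A :: "'a :: comm_ring_1 mat"
  assumes "similar_mat_wit A B P Q" and A: "A \<in> carrier_mat n n"
  shows "(\<Sum>i<n. A $$ (i,i)) = (\<Sum>i<n. B $$ (i,i))"
proof -
  note w = similar_mat_witD2[OF A assms(1)]
  have PB: "P * B \<in> carrier_mat n n" using w(5,6) by simp
  have "(\<Sum>i<n. A $$ (i,i)) = (\<Sum>i<n. \<Sum>j<n. (P * B) $$ (i,j) * Q $$ (j,i))"
    unfolding w(3) by (rule sum_diag_mult_mat[OF PB w(7)])
  also have "\<dots> = (\<Sum>j<n. \<Sum>i<n. Q $$ (j,i) * (P * B) $$ (i,j))"
    by (subst sum.swap, intro sum.cong refl mult.commute)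
  also have "\<dots> = (\<Sum>j<n. (Q * (P * B)) $$ (j,j))"
    by (rule sum_diag_mult_mat[OF w(7) PB, symmetric])
  also have "Q * (P * B) = B"
    by (simp only: assoc_mult_mat[OF w(7) w(6) w(5), symmetric] w(2) left_mult_one_mat[OF w(5)])
  finally show ?thesis .
qed

text \<open>The Schur form is similar to \<open>A\<close>, so it has the same trace and hence a
  nonzero diagonal entry. Its diagonal lists the roots of the characteristic polynomial, so that
  entry is an eigenvalue.\<close>

lemma nonzero_eigenvalue_of_nonzero_trace:
  fixes A :: "complex mat"
  assumes A: "A \<in> carrier_mat n n" and tr: "(\<Sum>i<n. A $$ (i,i)) \<noteq> 0"
  shows "\<exists>e u. e \<noteq> 0 \<and> eigenvector A u e"
proof -
  obtain es where es: "char_poly A = (\<Prod>e\<leftarrow>es. [:- e, 1:])"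
    using char_poly_factorized[OF A] by auto
  obtain B P Q where BPQ: "schur_decomposition A es = (B, P, Q)"
    by (cases "schur_decomposition A es") auto
  note s = schur_decomposition[OF A es BPQ]
  have B: "B \<in> carrier_mat n n" using s similar_mat_witD2[OF A] by blast
  have "(\<Sum>i<n. B $$ (i,i)) \<noteq> 0"
    using similar_mat_wit_sum_diag[OF conjunct1[OF s] A] tr by simp
  then obtain i where i: "i < n" "B $$ (i,i) \<noteq> 0"
    using sum.neutral[of "{..<n}" "\<lambda>i. B $$ (i,i)"] by blast
  have "B $$ (i,i) \<in> set (diag_mat B)" using i B by (simp add: diag_mat_def)
  hence "B $$ (i,i) \<in> set es" using s by simp
  hence "poly (char_poly A) (B $$ (i,i)) = 0"
    unfolding es poly_prod_list prod_list_zero_iff by force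
  hence "eigenvalue A (B $$ (i,i))" using eigenvalue_root_char_poly[OF A] by simp
  thus ?thesis using i unfolding eigenvalue_def by blast
qed

text \<open>Enumerating \<open>I\<close> by \<open>h\<close> turns the kernel into an honest matrix,
  and the eigenvector is carried back along the inverse \<open>g\<close>.\<close>

lemma op_nonzero_eigenvalue:
  assumes fin: "finite I" and tr: "op_trace I M \<noteq> 0"
  shows "\<exists>e u. e \<noteq> 0 \<and> (\<exists>i\<in>I. u i \<noteq> 0) \<and> (\<forall>i\<in>I. (\<Sum>j\<in>I. M i j * u j) = e * u i)"
proof -
  define n where "n = card I"
  obtain h where h: "bij_betw h {..<n} I"
    using fin unfolding n_def by (metis ex_bij_betw_nat_finite lessThan_atLeast0)
  define g where "g = the_inv_into {..<n} h"
  have gh: "g (h i) = i" if "i < n" for i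
    unfolding g_def using h that by (simp add: bij_betw_def the_inv_into_f_f)
  have hI: "h i \<in> I" if "i < n" for i using h that by (auto simp: bij_betw_def)
  have hex: "\<exists>m<n. i = h m" if "i \<in> I" for i using h that by (auto simp: bij_betw_def)
  define A where "A = mat n n (\<lambda>(i,j). M (h i) (h j))"
  have A: "A \<in> carrier_mat n n" unfolding A_def by simp
  have "(\<Sum>i<n. A $$ (i,i)) = op_trace I M"
    unfolding A_def op_trace_def using sum.reindex_bij_betw[OF h, of "\<lambda>i. M i i"] by simp
  then obtain e u where e: "e \<noteq> 0" and eu: "eigenvector A u e"
    using nonzero_eigenvalue_of_nonzero_trace[OF A] tr by auto
  have u: "u \<in> carrier_vec n" "u \<noteq> 0\<^sub>v n" and Au: "A *\<^sub>v u = e \<cdot>\<^sub>v u"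
    using eu A unfolding eigenvector_def by auto
  obtain m where m: "m < n" "u $ m \<noteq> 0" using u by (metis carrier_vecD eq_vecI index_zero_vec)
  have "(\<Sum>j\<in>I. M i j * (u $ g j)) = e * (u $ g i)" if i: "i \<in> I" for i
  proof -
    obtain k where k: "k < n" "i = h k" using hex[OF i] by blast
    have "(\<Sum>j\<in>I. M i j * (u $ g j)) = (\<Sum>j<n. M (h k) (h j) * u $ j)"
      by (subst sum.reindex_bij_betw[OF h, symmetric]) (simp add: gh k)
    also have "\<dots> = (A *\<^sub>v u) $ k"
      using k u by (simp add: A_def scalar_prod_def lessThan_atLeast0)
    also have "\<dots> = e * u $ k" using k u Au by simp
    finally show ?thesis using k gh by simp
  qed
  moreover have "\<exists>i\<in>I. u $ g i \<noteq> 0" using m hI gh by metis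
  ultimately show ?thesis using e by (intro exI[of _ e] exI[of _ "\<lambda>i. u $ g i"]) auto
qed

section \<open>Orthonormal families and eigenbases of Hermitian kernels\<close>

definition orthonormal :: "'i set \<Rightarrow> 'k set \<Rightarrow> ('k \<Rightarrow> 'i \<Rightarrow> complex) \<Rightarrow> bool" where
  "orthonormal I K v \<longleftrightarrow>
     (\<forall>k\<in>K. \<forall>l\<in>K. (\<Sum>i\<in>I. cnj (v k i) * v l i) = (if k = l then 1 else 0))"

text \<open>With the family as columns of \<open>B\<close> and its adjoint as \<open>A\<close>,
  orthonormality reads \<open>A * B = 1\<close>. For square matrices a one-sided inverse is
  two-sided, and \<open>B * A = 1\<close> is completeness.\<close>

lemma orthonormal_complete:
  assumes fin: "finite I" and on: "orthonormal I I v" and i: "i \<in> I" and j: "j \<in> I"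
  shows "(\<Sum>k\<in>I. v k i * cnj (v k j)) = (if i = j then 1 else 0)"
proof -
  define n where "n = card I"
  obtain h where h: "bij_betw h {..<n} I"
    using fin unfolding n_def by (metis ex_bij_betw_nat_finite lessThan_atLeast0)
  have hI: "h i \<in> I" if "i < n" for i using h that by (auto simp: bij_betw_def)
  have hex: "\<exists>m<n. i = h m" if "i \<in> I" for i using h that by (auto simp: bij_betw_def)
  have hinj: "h a = h b \<longleftrightarrow> a = b" if "a < n" "b < n" for a b
    using h that by (auto simp: bij_betw_def inj_on_def)
  define A where "A = mat n n (\<lambda>(k,i). cnj (v (h k) (h i)))"
  define B where "B = mat n n (\<lambda>(i,k). v (h k) (h i))"
  have "A * B = 1\<^sub>m n"
  proof (rule eq_matI)
    fix k l assume kl: "k < dim_row (1\<^sub>m n)" "l < dim_col (1\<^sub>m n)"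
    have "(A * B) $$ (k,l) = (\<Sum>i<n. cnj (v (h k) (h i)) * v (h l) (h i))"
      using kl by (simp add: A_def B_def scalar_prod_def lessThan_atLeast0)
    also have "\<dots> = (\<Sum>i\<in>I. cnj (v (h k) i) * v (h l) i)"
      by (rule sum.reindex_bij_betw[OF h])
    finally show "(A * B) $$ (k,l) = 1\<^sub>m n $$ (k,l)"
      using on kl hI hinj unfolding orthonormal_def by simp
  qed (auto simp: A_def B_def)
  moreover have "A \<in> carrier_mat n n" "B \<in> carrier_mat n n" by (simp_all add: A_def B_def)
  ultimately have BA: "B * A = 1\<^sub>m n" using mat_mult_left_right_inverse by blast
  obtain a b where ab: "a < n" "b < n" "i = h a" "j = h b" using hex i j by metis
  have "(\<Sum>k\<in>I. v k i * cnj (v k j)) = (\<Sum>k<n. v (h k) i * cnj (v (h k) j))"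
    by (rule sum.reindex_bij_betw[OF h, symmetric])
  also have "\<dots> = (B * A) $$ (a,b)"
    using ab by (simp add: A_def B_def scalar_prod_def lessThan_atLeast0)
  also have "\<dots> = (if i = j then 1 else 0)" unfolding BA using ab hinj by simp
  finally show ?thesis .
qed

definition ip :: "'i set \<Rightarrow> ('i \<Rightarrow> complex) \<Rightarrow> ('i \<Rightarrow> complex) \<Rightarrow> complex" where
  "ip I u v = (\<Sum>i\<in>I. cnj (u i) * v i)"

definition op_app :: "'i set \<Rightarrow> 'i op \<Rightarrow> ('i \<Rightarrow> complex) \<Rightarrow> 'i \<Rightarrow> complex" where
  "op_app I A u = (\<lambda>i. \<Sum>j\<in>I. A i j * u j)"

definition op_adj :: "'i op \<Rightarrow> 'i op" where
  "op_adj A = (\<lambda>i j. cnj (A j i))"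

lemma op_adj_adj [simp]: "op_adj (op_adj A) = A"
  by (simp add: op_adj_def)

lemma ip_cong:
  "(\<And>i. i \<in> I \<Longrightarrow> u i = u' i) \<Longrightarrow> (\<And>i. i \<in> I \<Longrightarrow> v i = v' i) \<Longrightarrow> ip I u v = ip I u' v'"
  by (simp add: ip_def)

lemma cnj_ip: "cnj (ip I u v) = ip I v u"
  by (simp add: ip_def mult.commute)

lemma ip_scale_left: "ip I (\<lambda>i. c * u i) v = cnj c * ip I u v"
  by (simp add: ip_def sum_distrib_left mult.assoc)

lemma ip_scale_right: "ip I u (\<lambda>i. c * v i) = c * ip I u v"
  by (simp add: ip_def sum_distrib_left mult_ac)

lemma ip_add_right: "ip I u (\<lambda>i. v i + w i) = ip I u v + ip I u w"
  by (simp add: ip_def ring_distribs sum.distrib)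

lemma ip_diff_right: "ip I u (\<lambda>i. v i - w i) = ip I u v - ip I u w"
  by (simp add: ip_def ring_distribs sum_subtractf)

lemma ip_sum_right: "ip I u (\<lambda>i. \<Sum>k\<in>K. f k i) = (\<Sum>k\<in>K. ip I u (f k))"
  unfolding ip_def sum_distrib_left by (rule sum.swap)

lemma ip_op_app: "ip I u (op_app I A v) = ip I (op_app I (op_adj A) u) v"
  unfolding ip_def op_app_def op_adj_def sum_distrib_left cnj_sum sum_distrib_right
  by (subst sum.swap) (simp add: mult_ac)

lemma ip_op_app_hermitian:
  assumes "op_hermitian I A"
  shows "ip I u (op_app I A v) = ip I (op_app I A u) v"
proof -
  have "cnj (A j i) = A i j" if "i \<in> I" "j \<in> I" for i j
    using assms that unfolding op_hermitian_def by metis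
  hence "op_app I (op_adj A) u i = op_app I A u i" if "i \<in> I" for i
    using that by (simp add: op_app_def op_adj_def)
  thus ?thesis unfolding ip_op_app by (intro ip_cong) auto
qed

lemma ip_self: "ip I u u = complex_of_real (\<Sum>i\<in>I. (cmod (u i))\<^sup>2)"
  by (simp only: ip_def of_real_sum complex_norm_square mult.commute)

lemma ip_self_pos:
  assumes "finite I" "i \<in> I" "u i \<noteq> 0"
  shows "0 < (\<Sum>i\<in>I. (cmod (u i))\<^sup>2)"
  using assms by (intro sum_pos2[of _ i]) auto

lemma orthonormal_ip:
  "orthonormal I K v \<Longrightarrow> k \<in> K \<Longrightarrow> l \<in> K \<Longrightarrow> ip I (v k) (v l) = (if k = l then 1 else 0)"
  by (simp add: orthonormal_def ip_def)

lemma orthonormal_iff_ip: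
  "orthonormal I K v \<longleftrightarrow> (\<forall>k\<in>K. \<forall>l\<in>K. ip I (v k) (v l) = (if k = l then 1 else 0))"
  by (simp add: orthonormal_def ip_def)

text \<open>Deflation: subtracting the known eigenspaces, after a shift making the trace nonzero,
  leaves an operator any of whose nonzero eigenvalues has its eigenvectors orthogonal to them.\<close>

lemma hermitian_extend_eigenbasis:
  fixes lam :: "'k \<Rightarrow> real"
  assumes fin: "finite I" and K: "finite K" "card K < card I" and herm: "op_hermitian I A"
    and on: "orthonormal I K v"
    and ev: "\<And>k i. k \<in> K \<Longrightarrow> i \<in> I \<Longrightarrow> op_app I A (v k) i = complex_of_real (lam k) * v k i"
  shows "\<exists>(e::real) u. ip I u u = 1 \<and> (\<forall>k\<in>K. ip I (v k) u = 0) \<and>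
           (\<forall>i\<in>I. op_app I A u i = complex_of_real e * u i)"
proof -
  define t where "t = op_trace I A - (\<Sum>k\<in>K. complex_of_real (lam k))"
  \<comment> \<open>The deflated operator has trace \<open>t + c * (card I - card K)\<close>. Since
    \<open>card K < card I\<close>, the choice \<open>c = 1\<close> makes this nonzero when
    \<open>t = 0\<close>.\<close>
  define c :: real where "c = (if t = 0 then 1 else 0)"
  define M where "M = (\<lambda>i j. A i j + (if i = j then complex_of_real c else 0)
      - (\<Sum>k\<in>K. complex_of_real (lam k + c) * v k i * cnj (v k j)))"
  have "op_trace I M = op_trace I A + c * of_nat (card I)
      - (\<Sum>k\<in>K. complex_of_real (lam k + c) * (\<Sum>i\<in>I. cnj (v k i) * v k i))"
    unfolding op_trace_def M_def sum_subtractf sum.distrib sum_distrib_left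
    by (subst sum.swap[of _ K I]) (simp add: mult_ac)
  also have "(\<Sum>k\<in>K. complex_of_real (lam k + c) * (\<Sum>i\<in>I. cnj (v k i) * v k i))
      = (\<Sum>k\<in>K. complex_of_real (lam k + c))"
    using on unfolding orthonormal_def by (intro sum.cong) auto
  also have "op_trace I A + c * of_nat (card I) - \<dots> = t + c * (of_nat (card I) - of_nat (card K))"
    unfolding t_def by (simp add: sum.distrib ring_distribs)
  finally have "op_trace I M = t + c * (of_nat (card I) - of_nat (card K))" .
  hence "op_trace I M \<noteq> 0" using K(2) unfolding c_def by auto
  from op_nonzero_eigenvalue[OF fin this]
  obtain e u i0 where e: "e \<noteq> 0" and i0: "i0 \<in> I" "u i0 \<noteq> 0"
    and Mu: "\<And>i. i \<in> I \<Longrightarrow> op_app I M u i = e * u i"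
    unfolding op_app_def by blast
  have Mapp: "op_app I M u i = op_app I A u i + c * u i
      - (\<Sum>k\<in>K. (complex_of_real (lam k + c) * ip I (v k) u) * v k i)" if i: "i \<in> I" for i
  proof -
    have "op_app I M u i = op_app I A u i + (\<Sum>j\<in>I. (if i = j then complex_of_real c else 0) * u j)
      - (\<Sum>j\<in>I. \<Sum>k\<in>K. complex_of_real (lam k + c) * v k i * cnj (v k j) * u j)"
      unfolding op_app_def M_def by (simp add: ring_distribs sum.distrib sum_subtractf sum_distrib_right)
    also have "(\<Sum>j\<in>I. (if i = j then complex_of_real c else 0) * u j) = c * u i"
      using i fin by (simp add: if_distrib[of "\<lambda>z. z * _"] cong: if_cong)
    also have "(\<Sum>j\<in>I. \<Sum>k\<in>K. complex_of_real (lam k + c) * v k i * cnj (v k j) * u j)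
       = (\<Sum>k\<in>K. (complex_of_real (lam k + c) * ip I (v k) u) * v k i)"
      unfolding ip_def sum_distrib_left sum_distrib_right by (subst sum.swap) (simp add: mult_ac)
    finally show ?thesis .
  qed
  \<comment> \<open>Pairing \<open>M u = e u\<close> with \<open>v l\<close>, the subtracted term
    cancels exactly the contribution \<open>lam l + c\<close> of the shifted operator, leaving
    \<open>e * ip I (v l) u = 0\<close> with \<open>e\<close> nonzero.\<close>
  have orth: "ip I (v l) u = 0" if l: "l \<in> K" for l
  proof -
    have "e * ip I (v l) u = ip I (v l) (\<lambda>i. e * u i)" by (simp only: ip_scale_right)
    also have "\<dots> = ip I (v l) (\<lambda>i. op_app I A u i + c * u i
      - (\<Sum>k\<in>K. (complex_of_real (lam k + c) * ip I (v k) u) * v k i))"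
      by (rule ip_cong) (simp_all only: Mu[symmetric] Mapp)
    also have "\<dots> = ip I (v l) (op_app I A u) + c * ip I (v l) u
       - (\<Sum>k\<in>K. (complex_of_real (lam k + c) * ip I (v k) u) * ip I (v l) (v k))"
      by (simp only: ip_diff_right ip_add_right ip_sum_right ip_scale_right)
    also have "ip I (v l) (op_app I A u) = ip I (\<lambda>i. complex_of_real (lam l) * v l i) u"
      unfolding ip_op_app_hermitian[OF herm] using ev[OF l] by (intro ip_cong) auto
    also have "\<dots> = complex_of_real (lam l) * ip I (v l) u" by (simp add: ip_scale_left)
    also have "(\<Sum>k\<in>K. (complex_of_real (lam k + c) * ip I (v k) u) * ip I (v l) (v k))
      = (\<Sum>k\<in>K. if l = k then complex_of_real (lam k + c) * ip I (v k) u else 0)"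
      using orthonormal_ip[OF on l] by (intro sum.cong) auto
    also have "\<dots> = complex_of_real (lam l + c) * ip I (v l) u" using l K by simp
    finally show ?thesis using e by (simp add: ring_distribs)
  qed
  have Au: "op_app I A u i = (e - c) * u i" if "i \<in> I" for i
    using Mu[OF that] Mapp[OF that] orth by (simp add: algebra_simps)
  define s where "s = (\<Sum>i\<in>I. (cmod (u i))\<^sup>2)"
  have s: "s > 0" "ip I u u = s" unfolding s_def using ip_self_pos[OF fin, of i0 u] i0 ip_self by auto
  \<comment> \<open>Moving \<open>A\<close> to the other side of the inner product shows that
    \<open>e - c\<close> equals its own conjugate, so the eigenvalue is real.\<close>
  have "(e - c) * ip I u u = ip I u (\<lambda>i. (e - c) * u i)" by (simp only: ip_scale_right)
  also have "\<dots> = ip I u (op_app I A u)" by (rule ip_cong) (simp_all only: Au)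
  also have "\<dots> = ip I (\<lambda>i. (e - c) * u i) u"
    unfolding ip_op_app_hermitian[OF herm] by (rule ip_cong) (simp_all only: Au)
  also have "\<dots> = cnj (e - c) * ip I u u" by (simp only: ip_scale_left)
  finally have "e - c = cnj (e - c)" using s by simp
  hence real: "e - c = complex_of_real (Re (e - c))" by (simp add: complex_eq_iff)
  define r where "r = complex_of_real (1 / sqrt s)"
  have "cnj r * (r * s) = complex_of_real (1 / sqrt s * (1 / sqrt s * s))"
    by (simp only: r_def complex_cnj_complex_of_real of_real_mult)
  also have "1 / sqrt s * (1 / sqrt s * s) = 1"
    using s by (simp add: field_simps)
  finally have "ip I (\<lambda>i. r * u i) (\<lambda>i. r * u i) = 1"
    by (simp add: ip_scale_left ip_scale_right s)
  moreover have "op_app I A (\<lambda>i. r * u i) i = complex_of_real (Re (e - c)) * (r * u i)" if "i \<in> I" for i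
  proof -
    have "op_app I A (\<lambda>i. r * u i) i = r * op_app I A u i"
      by (simp add: op_app_def sum_distrib_left mult_ac)
    also have "\<dots> = (e - c) * (r * u i)" using Au[OF that] by (simp only: mult.left_commute)
    finally show ?thesis by (subst real[symmetric])
  qed
  ultimately show ?thesis
    using orth by (intro exI[of _ "Re (e - c)"] exI[of _ "\<lambda>i. r * u i"]) (simp add: ip_scale_right)
qed

text \<open>The eigenvectors are labelled by elements of \<open>I\<close> itself, as
  \<open>spec_dec\<close> demands, so the basis is grown one label at a time along subsets
  \<open>K\<close> of \<open>I\<close>.\<close>

lemma hermitian_eigenbasis:
  assumes fin: "finite I" and herm: "op_hermitian I A" and K: "K \<subseteq> I"
  shows "\<exists>v (lam :: 'i \<Rightarrow> real). orthonormal I K v \<and>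
           (\<forall>k\<in>K. \<forall>i\<in>I. op_app I A (v k) i = complex_of_real (lam k) * v k i)"
proof -
  have "finite K" using fin K finite_subset by blast
  from this K show ?thesis
  proof (induction K rule: finite_induct)
    case empty
    show ?case by (simp add: orthonormal_def)
  next
    case (insert x K)
    then obtain v and lam :: "'i \<Rightarrow> real" where on: "orthonormal I K v"
      and ev: "\<forall>k\<in>K. \<forall>i\<in>I. op_app I A (v k) i = complex_of_real (lam k) * v k i" by auto
    have "card K < card I"
      using insert.hyps insert.prems fin by (intro psubset_card_mono) auto
    from hermitian_extend_eigenbasis[OF fin insert.hyps(1) this herm on, of lam] ev
    obtain e :: real and u where u: "ip I u u = 1" "\<forall>k\<in>K. ip I (v k) u = 0"
      "\<forall>i\<in>I. op_app I A u i = complex_of_real e * u i" by blast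
    have u': "ip I u (v k) = 0" if "k \<in> K" for k
      using u(2) that cnj_ip[of I "v k" u] by simp
    have nx: "k \<noteq> x" if "k \<in> K" for k using insert.hyps that by auto
    have "orthonormal I (insert x K) (v(x := u))"
      unfolding orthonormal_iff_ip using u u' nx orthonormal_ip[OF on] by auto
    moreover have "\<forall>k\<in>insert x K. \<forall>i\<in>I. op_app I A ((v(x := u)) k) i
        = complex_of_real ((lam(x := e)) k) * (v(x := u)) k i"
      using u ev nx by auto
    ultimately show ?case by blast
  qed
qed

section \<open>Spectral decompositions, functional calculus and traces\<close>

lemma spec_dec_orthonormal: "spec_dec I A v lam \<Longrightarrow> orthonormal I I v"
  by (simp add: spec_dec_def orthonormal_def)

text \<open>Summing the eigenvector equations against \<open>cnj (v k j)\<close> and inserting the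
  completeness relation recovers the kernel, so eigenvector equations suffice.\<close>

lemma spec_decI:
  assumes fin: "finite I" and on: "orthonormal I I v"
    and ev: "\<And>k i. k \<in> I \<Longrightarrow> i \<in> I \<Longrightarrow> op_app I A (v k) i = complex_of_real (lam k) * v k i"
  shows "spec_dec I A v lam"
proof -
  have "A i j = (\<Sum>k\<in>I. complex_of_real (lam k) * v k i * cnj (v k j))" if i: "i \<in> I" and j: "j \<in> I" for i j
  proof -
    have "(\<Sum>k\<in>I. complex_of_real (lam k) * v k i * cnj (v k j))
      = (\<Sum>k\<in>I. op_app I A (v k) i * cnj (v k j))" using ev i by simp
    also have "\<dots> = (\<Sum>m\<in>I. A i m * (\<Sum>k\<in>I. v k m * cnj (v k j)))"
      unfolding op_app_def sum_distrib_left sum_distrib_right by (subst sum.swap) (simp add: mult_ac)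
    also have "\<dots> = (\<Sum>m\<in>I. if m = j then A i m else 0)"
      using orthonormal_complete[OF fin on _ j] by (intro sum.cong) auto
    also have "\<dots> = A i j" using fin j by simp
    finally show ?thesis by simp
  qed
  thus ?thesis using on unfolding spec_dec_def orthonormal_def by blast
qed

theorem spec_dec_exists:
  assumes "finite I" "op_hermitian I A"
  shows "\<exists>v lam. spec_dec I A v lam"
proof -
  obtain v and lam :: "'a \<Rightarrow> real" where "orthonormal I I v"
    "\<forall>k\<in>I. \<forall>i\<in>I. op_app I A (v k) i = complex_of_real (lam k) * v k i"
    using hermitian_eigenbasis[OF assms subset_refl] by blast
  thus ?thesis using spec_decI[OF assms(1)] by blast
qed

lemma orthonormal_expand:
  assumes "finite I" "orthonormal I I w" "i \<in> I"
  shows "(\<Sum>l\<in>I. ip I (w l) u * w l i) = u i"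
proof -
  have "(\<Sum>l\<in>I. ip I (w l) u * w l i) = (\<Sum>j\<in>I. u j * (\<Sum>l\<in>I. w l i * cnj (w l j)))"
    unfolding ip_def sum_distrib_left sum_distrib_right by (subst sum.swap) (simp add: mult_ac)
  also have "\<dots> = (\<Sum>j\<in>I. if i = j then u j else 0)"
    using orthonormal_complete[OF assms] by (intro sum.cong) auto
  finally show ?thesis using assms by simp
qed

lemma parseval:
  assumes "finite I" "orthonormal I I w"
  shows "ip I u u' = (\<Sum>l\<in>I. ip I u (w l) * ip I (w l) u')"
proof -
  have "ip I u u' = ip I u (\<lambda>i. \<Sum>l\<in>I. ip I (w l) u' * w l i)"
    by (rule ip_cong) (simp_all add: orthonormal_expand[OF assms])
  thus ?thesis by (simp only: ip_sum_right ip_scale_right) (simp only: mult.commute)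
qed

lemma parseval_norm:
  assumes "finite I" "orthonormal I I w"
  shows "ip I u u = complex_of_real (\<Sum>l\<in>I. (cmod (ip I (w l) u))\<^sup>2)"
  unfolding parseval[OF assms, of u u] of_real_sum complex_norm_square
  by (simp add: cnj_ip mult.commute)

lemma spec_dec_hermitian: "spec_dec I A v lam \<Longrightarrow> op_hermitian I A"
  by (simp add: spec_dec_def op_hermitian_def mult_ac)

lemma spec_dec_eigenvector:
  assumes "finite I" "spec_dec I A v lam" "l \<in> I" "i \<in> I"
  shows "op_app I A (v l) i = complex_of_real (lam l) * v l i"
proof -
  have "op_app I A (v l) i = (\<Sum>j\<in>I. (\<Sum>k\<in>I. complex_of_real (lam k) * v k i * cnj (v k j)) * v l j)"
    using assms unfolding op_app_def spec_dec_def by simp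
  also have "\<dots> = (\<Sum>k\<in>I. complex_of_real (lam k) * v k i * ip I (v k) (v l))"
    unfolding ip_def sum_distrib_left sum_distrib_right by (subst sum.swap) (simp add: mult_ac)
  also have "\<dots> = (\<Sum>k\<in>I. if k = l then complex_of_real (lam k) * v k i else 0)"
    using orthonormal_ip[OF spec_dec_orthonormal[OF assms(2)]] assms(3) by (intro sum.cong) auto
  finally show ?thesis using assms by simp
qed

lemma ip_spec_dec_app:
  assumes "finite I" "spec_dec I A v lam" "l \<in> I"
  shows "ip I (v l) (op_app I A u) = complex_of_real (lam l) * ip I (v l) u"
proof -
  have "ip I (v l) (op_app I A u) = ip I (\<lambda>i. complex_of_real (lam l) * v l i) u"
    unfolding ip_op_app_hermitian[OF spec_dec_hermitian[OF assms(2)]]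
    by (rule ip_cong) (simp_all add: spec_dec_eigenvector[OF assms])
  thus ?thesis by (simp add: ip_scale_left)
qed

text \<open>Eigenvectors for different eigenvalues are orthogonal, so two eigenbases of one operator
  overlap only where the eigenvalues, and hence their images under \<open>f\<close>, agree.\<close>

lemma spec_dec_eigenvectors_match:
  assumes fin: "finite I" and v: "spec_dec I A v lam" and w: "spec_dec I A w mu" and kl: "k \<in> I" "l \<in> I"
  shows "complex_of_real (f (lam k)) * ip I (v k) (w l) = complex_of_real (f (mu l)) * ip I (v k) (w l)"
proof -
  have "complex_of_real (lam k) * ip I (v k) (w l) = ip I (v k) (op_app I A (w l))"
    by (simp add: ip_spec_dec_app[OF fin v kl(1)])
  also have "\<dots> = ip I (v k) (\<lambda>i. complex_of_real (mu l) * w l i)"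
    by (rule ip_cong) (simp_all add: spec_dec_eigenvector[OF fin w kl(2)])
  also have "\<dots> = complex_of_real (mu l) * ip I (v k) (w l)" by (rule ip_scale_right)
  finally have "lam k = mu l \<or> ip I (v k) (w l) = 0" by auto
  thus ?thesis by auto
qed

text \<open>\<open>op_fun\<close> is built on an eigenbasis picked by \<open>SOME\<close>. This
  lemma makes it independent of that choice: any eigenbasis of \<open>A\<close> may be used to
  compute it.\<close>

lemma spec_dec_op_fun:
  assumes fin: "finite I" and w: "spec_dec I A w mu"
  shows "spec_dec I (op_fun I f A) w (\<lambda>k. f (mu k))"
proof -
  obtain v lam where vl: "(SOME (v, lam). spec_dec I A v lam) = (v, lam)" by (meson surj_pair)
  have v: "spec_dec I A v lam"
    using someI_ex[of "\<lambda>(v, lam). spec_dec I A v lam"] w vl by auto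
  have F: "op_fun I f A i j = (\<Sum>k\<in>I. complex_of_real (f (lam k)) * v k i * cnj (v k j))"
    if "i \<in> I" "j \<in> I" for i j
    using that unfolding op_fun_def vl by simp
  show ?thesis
  proof (rule spec_decI[OF fin spec_dec_orthonormal[OF w]])
    fix l i assume l: "l \<in> I" and i: "i \<in> I"
    have "op_app I (op_fun I f A) (w l) i
        = (\<Sum>j\<in>I. (\<Sum>k\<in>I. complex_of_real (f (lam k)) * v k i * cnj (v k j)) * w l j)"
      unfolding op_app_def using F i by simp
    also have "\<dots> = (\<Sum>k\<in>I. complex_of_real (f (lam k)) * ip I (v k) (w l) * v k i)"
      unfolding ip_def sum_distrib_left sum_distrib_right by (subst sum.swap) (simp add: mult_ac)
    also have "\<dots> = (\<Sum>k\<in>I. complex_of_real (f (mu l)) * (ip I (v k) (w l) * v k i))"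
      using spec_dec_eigenvectors_match[OF fin v w _ l] by (intro sum.cong) auto
    also have "\<dots> = complex_of_real (f (mu l)) * w l i"
      unfolding sum_distrib_left[symmetric]
      using orthonormal_expand[OF fin spec_dec_orthonormal[OF v] i] by simp
    finally show "op_app I (op_fun I f A) (w l) i = complex_of_real (f (mu l)) * w l i" .
  qed
qed

lemma trace_mult_spec_dec:
  assumes "spec_dec I A v lam"
  shows "op_trace I (op_mult I A X) = (\<Sum>k\<in>I. complex_of_real (lam k) * ip I (v k) (op_app I X (v k)))"
proof -
  have "op_trace I (op_mult I A X)
     = (\<Sum>i\<in>I. \<Sum>j\<in>I. \<Sum>k\<in>I. complex_of_real (lam k) * v k i * cnj (v k j) * X j i)"
    using assms unfolding op_trace_def op_mult_def spec_dec_def by (simp add: sum_distrib_right)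
  also have "\<dots> = (\<Sum>k\<in>I. \<Sum>i\<in>I. \<Sum>j\<in>I. complex_of_real (lam k) * v k i * cnj (v k j) * X j i)"
    by (subst (2) sum.swap, subst sum.swap) simp
  also have "\<dots> = (\<Sum>k\<in>I. complex_of_real (lam k) * ip I (v k) (op_app I X (v k)))"
    unfolding ip_def op_app_def sum_distrib_left
    by (rule sum.cong[OF refl], subst sum.swap) (simp add: mult_ac)
  finally show ?thesis .
qed

text \<open>Parseval in the basis \<open>w\<close> expands each diagonal element of \<open>B\<close>
  in the basis \<open>v\<close>, so the trace becomes a double sum weighted by squared
  overlaps.\<close>

lemma trace_mult_two_spec_dec:
  assumes fin: "finite I" and v: "spec_dec I A v lam" and w: "spec_dec I B w mu"
  shows "op_trace I (op_mult I A B)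
     = complex_of_real (\<Sum>k\<in>I. \<Sum>l\<in>I. (cmod (ip I (w l) (v k)))\<^sup>2 * (lam k * mu l))"
  unfolding trace_mult_spec_dec[OF v] of_real_sum
proof (rule sum.cong[OF refl])
  fix k assume "k \<in> I"
  have "ip I (v k) (op_app I B (v k)) = (\<Sum>l\<in>I. ip I (v k) (w l) * (complex_of_real (mu l) * ip I (w l) (v k)))"
    unfolding parseval[OF fin spec_dec_orthonormal[OF w], of "v k" "op_app I B (v k)"]
    by (intro sum.cong refl) (simp add: ip_spec_dec_app[OF fin w])
  thus "complex_of_real (lam k) * ip I (v k) (op_app I B (v k))
     = (\<Sum>l\<in>I. complex_of_real ((cmod (ip I (w l) (v k)))\<^sup>2 * (lam k * mu l)))"
    unfolding of_real_mult complex_norm_square by (simp add: sum_distrib_left cnj_ip mult_ac)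
qed

lemma trace_mult_same_basis:
  assumes fin: "finite I" and v: "spec_dec I A v lam" and w: "spec_dec I B v mu"
  shows "op_trace I (op_mult I A B) = complex_of_real (\<Sum>k\<in>I. lam k * mu k)"
proof -
  have "(\<Sum>l\<in>I. (cmod (ip I (v l) (v k)))\<^sup>2 * (lam k * mu l)) = lam k * mu k" if k: "k \<in> I" for k
  proof -
    have "(\<Sum>l\<in>I. (cmod (ip I (v l) (v k)))\<^sup>2 * (lam k * mu l)) = (\<Sum>l\<in>I. if l = k then lam k * mu l else 0)"
      using orthonormal_ip[OF spec_dec_orthonormal[OF v] _ k] by (intro sum.cong) auto
    thus ?thesis using fin k by simp
  qed
  thus ?thesis unfolding trace_mult_two_spec_dec[OF fin v w] by simp
qed

lemma trace_spec_dec: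
  assumes fin: "finite I" and v: "spec_dec I A v lam"
  shows "op_trace I A = complex_of_real (\<Sum>k\<in>I. lam k)"
proof -
  have "op_trace I A = (\<Sum>k\<in>I. complex_of_real (lam k) * ip I (v k) (v k))"
    using v unfolding op_trace_def spec_dec_def ip_def sum_distrib_left
    by (subst sum.swap) (simp add: mult_ac)
  thus ?thesis using orthonormal_ip[OF spec_dec_orthonormal[OF v]] by simp
qed

lemma overlap_sum:
  assumes "finite I" "orthonormal I I v" "orthonormal I I w" "k \<in> I"
  shows "(\<Sum>l\<in>I. (cmod (ip I (w l) (v k)))\<^sup>2) = 1"
  using parseval_norm[OF assms(1,3), of "v k"] orthonormal_ip[OF assms(2,4,4)]
  by (metis of_real_eq_1_iff)

section \<open>Entropy and relative entropy in eigenbases\<close>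

definition entropy :: "'i set \<Rightarrow> 'i op \<Rightarrow> real" where
  "entropy I \<rho> = - Re (op_trace I (op_mult I \<rho> (op_fun I log0 \<rho>)))"

lemma rel_ent_eq:
  "rel_ent I \<rho> \<sigma> = - entropy I \<rho> - Re (op_trace I (op_mult I \<rho> (op_fun I log0 \<sigma>)))"
  unfolding rel_ent_def entropy_def op_trace_def op_mult_def
  by (simp add: ring_distribs sum_subtractf)

lemma entropy_spec_dec:
  assumes "finite I" "spec_dec I \<rho> v p"
  shows "entropy I \<rho> = - (\<Sum>k\<in>I. p k * log0 (p k))"
  unfolding entropy_def trace_mult_same_basis[OF assms spec_dec_op_fun[OF assms]] by simp

text \<open>As the squared overlaps sum to one over \<open>l\<close>, the entropy term also becomes
  a sum over pairs. The relative entropy then looks like a classical one on pairs of eigenvalue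
  labels.\<close>

lemma rel_ent_spec_dec:
  assumes fin: "finite I" and v: "spec_dec I \<rho> v p" and w: "spec_dec I \<sigma> w q"
  shows "rel_ent I \<rho> \<sigma> = (\<Sum>k\<in>I. \<Sum>l\<in>I. (cmod (ip I (w l) (v k)))\<^sup>2 * (p k * (log0 (p k) - log0 (q l))))"
proof -
  have "entropy I \<rho> = - (\<Sum>k\<in>I. \<Sum>l\<in>I. (cmod (ip I (w l) (v k)))\<^sup>2 * (p k * log0 (p k)))"
    unfolding entropy_spec_dec[OF fin v] sum_distrib_right[symmetric]
    using overlap_sum[OF fin spec_dec_orthonormal[OF v] spec_dec_orthonormal[OF w]] by simp
  thus ?thesis
    unfolding rel_ent_eq trace_mult_two_spec_dec[OF fin v spec_dec_op_fun[OF fin w]]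
    by (simp add: ring_distribs sum_subtractf)
qed

section \<open>Monotonicity of the relative entropy\<close>

text \<open>For a positive definite \<open>\<sigma>\<close>, the supremum of this functional over \<open>X\<close> is
  \<open>tr[\<rho> (s R_\<rho> + L_\<sigma>)\<inverse> \<rho>]\<close>, the derivative in \<open>s\<close> of the quantity whose increment over
  \<open>[0, \<infinity>)\<close> is, up to a term in \<open>tr \<rho>\<close>, the relative entropy.\<close>

definition resolvent_functional :: "'i set \<Rightarrow> 'i op \<Rightarrow> 'i op \<Rightarrow> real \<Rightarrow> 'i op \<Rightarrow> real" where
  "resolvent_functional I \<rho> \<sigma> s X =
     2 * Re (op_trace I (op_mult I \<rho> X))
     - s * Re (op_trace I (op_mult I \<rho> (op_mult I (op_adj X) X)))
     - Re (op_trace I (op_mult I \<sigma> (op_mult I X (op_adj X))))"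

lemma op_app_op_mult: "op_app I (op_mult I A B) u = op_app I A (op_app I B u)"
  unfolding op_app_def op_mult_def sum_distrib_left sum_distrib_right
  by (rule ext, subst sum.swap) (simp add: mult_ac)

text \<open>In terms of the matrix elements of \<open>X\<close> between the eigenbases
  \<open>v\<close> and \<open>w\<close>, the functional splits into independent scalar quadratics,
  one per pair of labels.\<close>

lemma resolvent_functional_spec_dec:
  assumes fin: "finite I" and v: "spec_dec I \<rho> v p" and w: "spec_dec I \<sigma> w q"
  shows "resolvent_functional I \<rho> \<sigma> s X =
    (\<Sum>k\<in>I. \<Sum>l\<in>I. 2 * p k * Re (cnj (ip I (w l) (v k)) * ip I (w l) (op_app I X (v k)))
       - (s * p k + q l) * (cmod (ip I (w l) (op_app I X (v k))))\<^sup>2)"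
proof -
  note onv = spec_dec_orthonormal[OF v] and onw = spec_dec_orthonormal[OF w]
  define x where "x l k = ip I (w l) (op_app I X (v k))" for l k
  have "op_trace I (op_mult I \<rho> X)
      = (\<Sum>k\<in>I. complex_of_real (p k) * (\<Sum>l\<in>I. cnj (ip I (w l) (v k)) * x l k))"
    unfolding trace_mult_spec_dec[OF v] x_def cnj_ip
    by (intro sum.cong refl arg_cong2[where f = "(*)"] parseval[OF fin onw])
  hence 1: "Re (op_trace I (op_mult I \<rho> X))
      = (\<Sum>k\<in>I. \<Sum>l\<in>I. p k * Re (cnj (ip I (w l) (v k)) * x l k))"
    unfolding sum_distrib_left Re_sum by simp
  have "ip I (v k) (op_app I (op_mult I (op_adj X) X) (v k)) = (\<Sum>l\<in>I. (cmod (x l k))\<^sup>2)" for k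
    unfolding op_app_op_mult ip_op_app[of _ _ "op_adj X"] op_adj_adj parseval_norm[OF fin onw] x_def ..
  hence 2: "Re (op_trace I (op_mult I \<rho> (op_mult I (op_adj X) X))) = (\<Sum>k\<in>I. \<Sum>l\<in>I. p k * (cmod (x l k))\<^sup>2)"
    unfolding trace_mult_spec_dec[OF v] by (simp add: sum_distrib_left)
  have "cmod (ip I (v k) (op_app I (op_adj X) (w l))) = cmod (x l k)" for k l
    using complex_mod_cnj[of "ip I (v k) (op_app I (op_adj X) (w l))"]
    unfolding x_def ip_op_app[of _ _ X] cnj_ip by simp
  hence "ip I (w l) (op_app I (op_mult I X (op_adj X)) (w l)) = (\<Sum>k\<in>I. (cmod (x l k))\<^sup>2)" for l
    unfolding op_app_op_mult ip_op_app[of _ _ X] parseval_norm[OF fin onv] by simp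
  hence "Re (op_trace I (op_mult I \<sigma> (op_mult I X (op_adj X)))) = (\<Sum>l\<in>I. \<Sum>k\<in>I. q l * (cmod (x l k))\<^sup>2)"
    unfolding trace_mult_spec_dec[OF w] by (simp add: sum_distrib_left)
  also have "\<dots> = (\<Sum>k\<in>I. \<Sum>l\<in>I. q l * (cmod (x l k))\<^sup>2)" by (rule sum.swap)
  finally have 3: "Re (op_trace I (op_mult I \<sigma> (op_mult I X (op_adj X))))
      = (\<Sum>k\<in>I. \<Sum>l\<in>I. q l * (cmod (x l k))\<^sup>2)" .
  show ?thesis
    unfolding resolvent_functional_def 1 2 3 x_def[symmetric]
    by (simp add: sum_distrib_left sum_subtractf sum.distrib distrib_right mult.assoc)
qed

text \<open>Expand the nonnegative square of \<open>a x - p u\<close> and divide by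
  \<open>a\<close>.\<close>

lemma complete_square_le:
  fixes a p :: real and u x :: complex
  assumes a: "a > 0"
  shows "2 * p * Re (cnj u * x) - a * (cmod x)\<^sup>2 \<le> (cmod u)\<^sup>2 * (p * p / a)"
proof -
  have "0 \<le> (cmod (complex_of_real a * x - complex_of_real p * u))\<^sup>2" by simp
  also have "\<dots> = a * (a * (cmod x)\<^sup>2 - 2 * p * Re (cnj u * x)) + (p * p) * (cmod u)\<^sup>2"
    unfolding cmod_power2 by (simp add: power2_eq_square algebra_simps)
  finally have "0 \<le> (a * (a * (cmod x)\<^sup>2 - 2 * p * Re (cnj u * x)) + (p * p) * (cmod u)\<^sup>2) / a"
    using a by simp
  also have "\<dots> = (a * (cmod x)\<^sup>2 - 2 * p * Re (cnj u * x)) + (cmod u)\<^sup>2 * (p * p / a)"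
    using a by (simp add: field_simps)
  finally show ?thesis by simp
qed

lemma resolvent_functional_le:
  assumes fin: "finite I" and v: "spec_dec I \<rho> v p" and w: "spec_dec I \<sigma> w q"
    and "\<And>k. k \<in> I \<Longrightarrow> 0 \<le> p k" "\<And>l. l \<in> I \<Longrightarrow> 0 < q l" "0 \<le> s"
  shows "resolvent_functional I \<rho> \<sigma> s X \<le>
    (\<Sum>k\<in>I. \<Sum>l\<in>I. (cmod (ip I (w l) (v k)))\<^sup>2 * (p k * p k / (s * p k + q l)))"
proof -
  have "0 < s * p k + q l" if "k \<in> I" "l \<in> I" for k l
    using assms(4-6) that by (simp add: add_nonneg_pos)
  thus ?thesis
    unfolding resolvent_functional_spec_dec[OF fin v w] by (intro sum_mono complete_square_le)
qed

text \<open>Equality in the completed square forces the matrix element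
  \<open>p k / (s * p k + q l)\<close> times the overlap. The kernel \<open>X\<close> is assembled
  from exactly these elements.\<close>

lemma resolvent_functional_attained:
  assumes fin: "finite I" and v: "spec_dec I \<rho> v p" and w: "spec_dec I \<sigma> w q"
    and "\<And>k. k \<in> I \<Longrightarrow> 0 \<le> p k" "\<And>l. l \<in> I \<Longrightarrow> 0 < q l" "0 \<le> s"
  shows "\<exists>X. resolvent_functional I \<rho> \<sigma> s X =
    (\<Sum>k\<in>I. \<Sum>l\<in>I. (cmod (ip I (w l) (v k)))\<^sup>2 * (p k * p k / (s * p k + q l)))"
proof -
  define x where "x l k = complex_of_real (p k / (s * p k + q l)) * ip I (w l) (v k)" for l k
  define X where "X = (\<lambda>i j. \<Sum>k\<in>I. \<Sum>l\<in>I. x l k * w l i * cnj (v k j))"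
  have Xv: "ip I (w l) (op_app I X (v k)) = x l k" if k: "k \<in> I" and l: "l \<in> I" for k l
  proof -
    have "op_app I X (v k) = (\<lambda>i. \<Sum>k'\<in>I. \<Sum>l'\<in>I. (x l' k' * ip I (v k') (v k)) * w l' i)"
      unfolding op_app_def X_def ip_def sum_distrib_left sum_distrib_right
      by (rule ext, subst sum.swap, rule sum.cong[OF refl], subst sum.swap) (simp add: mult_ac)
    hence "ip I (w l) (op_app I X (v k))
        = (\<Sum>k'\<in>I. \<Sum>l'\<in>I. x l' k' * ip I (v k') (v k) * ip I (w l) (w l'))"
      by (simp add: ip_sum_right ip_scale_right)
    also have "\<dots> = (\<Sum>k'\<in>I. \<Sum>l'\<in>I. if l' = l then (if k' = k then x l' k' else 0) else 0)"
      using orthonormal_ip[OF spec_dec_orthonormal[OF v] _ k] orthonormal_ip[OF spec_dec_orthonormal[OF w] l]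
      by (intro sum.cong) auto
    also have "\<dots> = x l k" using fin k l by simp
    finally show ?thesis .
  qed
  have "2 * p k * Re (cnj (ip I (w l) (v k)) * x l k) - (s * p k + q l) * (cmod (x l k))\<^sup>2
      = (cmod (ip I (w l) (v k)))\<^sup>2 * (p k * p k / (s * p k + q l))" if k: "k \<in> I" and l: "l \<in> I" for k l
  proof -
    define a where "a = s * p k + q l"
    define u where "u = ip I (w l) (v k)"
    have a: "a > 0" unfolding a_def using assms(4-6) k l by (simp add: add_nonneg_pos)
    have "cnj u * x l k = complex_of_real (p k / a * (cmod u)\<^sup>2)"
      unfolding x_def a_def[symmetric] u_def[symmetric] of_real_mult complex_norm_square by (simp add: mult_ac)
    hence "Re (cnj u * x l k) = p k / a * (cmod u)\<^sup>2" by simp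
    moreover have "(cmod (x l k))\<^sup>2 = (p k / a)\<^sup>2 * (cmod u)\<^sup>2"
      unfolding x_def a_def[symmetric] u_def[symmetric] norm_mult power_mult_distrib norm_of_real power2_abs ..
    moreover have "2 * p k * (p k / a * (cmod u)\<^sup>2) - a * ((p k / a)\<^sup>2 * (cmod u)\<^sup>2)
        = (cmod u)\<^sup>2 * (p k * p k / a)"
      using a by (simp add: power2_eq_square)
    ultimately show ?thesis unfolding a_def[symmetric] u_def[symmetric] by (simp only:)
  qed
  hence "resolvent_functional I \<rho> \<sigma> s X =
    (\<Sum>k\<in>I. \<Sum>l\<in>I. (cmod (ip I (w l) (v k)))\<^sup>2 * (p k * p k / (s * p k + q l)))"
    unfolding resolvent_functional_spec_dec[OF fin v w] by (intro sum.cong refl) (simp add: Xv)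
  thus ?thesis by blast
qed

text \<open>This is the integration over \<open>s\<close>, done without integrals.
  \<open>F - F'\<close> has nonnegative derivative, so its value at \<open>0\<close>, which carries
  the \<open>q\<close> logarithms, is at most its limit at infinity, which carries the
  \<open>p\<close> logarithms.\<close>

lemma relative_entropy_sum_le:
  fixes a p q :: "'t \<Rightarrow> real" and a' p' q' :: "'u \<Rightarrow> real"
  assumes p: "\<And>t. t \<in> T \<Longrightarrow> 0 \<le> p t" and q: "\<And>t. t \<in> T \<Longrightarrow> 0 < q t"
    and p': "\<And>t. t \<in> T' \<Longrightarrow> 0 \<le> p' t" and q': "\<And>t. t \<in> T' \<Longrightarrow> 0 < q' t"
    and mass: "(\<Sum>t\<in>T'. a' t * p' t) = (\<Sum>t\<in>T. a t * p t)"
    and le: "\<And>s. 0 \<le> s \<Longrightarrow> (\<Sum>t\<in>T'. a' t * (p' t * p' t / (s * p' t + q' t)))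
                 \<le> (\<Sum>t\<in>T. a t * (p t * p t / (s * p t + q t)))"
  shows "(\<Sum>t\<in>T'. a' t * (p' t * (log0 (p' t) - log0 (q' t))))
       \<le> (\<Sum>t\<in>T. a t * (p t * (log0 (p t) - log0 (q t))))"
proof -
  define F where "F s = (\<Sum>t\<in>T. a t * (p t * ln (s * p t + q t)))" for s
  define F' where "F' s = (\<Sum>t\<in>T'. a' t * (p' t * ln (s * p' t + q' t)))" for s
  have pos: "0 < s * p t + q t" if "0 \<le> s" "t \<in> T" for s t
    using p q that by (simp add: add_nonneg_pos)
  have pos': "0 < s * p' t + q' t" if "0 \<le> s" "t \<in> T'" for s t
    using p' q' that by (simp add: add_nonneg_pos)
  have D: "(F has_real_derivative (\<Sum>t\<in>T. a t * (p t * p t / (s * p t + q t)))) (at s)" if "0 \<le> s" for s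
    unfolding F_def using pos[OF that] by (auto intro!: derivative_eq_intros sum.cong)
  have D': "(F' has_real_derivative (\<Sum>t\<in>T'. a' t * (p' t * p' t / (s * p' t + q' t)))) (at s)" if "0 \<le> s" for s
    unfolding F'_def using pos'[OF that] by (auto intro!: derivative_eq_intros sum.cong)
  have mono: "F 0 - F' 0 \<le> F s - F' s" if "0 \<le> s" for s
  proof (rule DERIV_nonneg_imp_nondecreasing[OF that])
    fix x :: real assume x: "0 \<le> x"
    show "\<exists>y. ((\<lambda>s. F s - F' s) has_real_derivative y) (at x) \<and> 0 \<le> y"
      using DERIV_diff[OF D[OF x] D'[OF x]] le[OF x] diff_ge_0_iff_ge by blast
  qed
  \<comment> \<open>Subtracting \<open>p * ln s\<close> removes the divergence, because
    \<open>ln (s * p + q) - ln s = ln (p + q / s)\<close>. For \<open>p = 0\<close> both sides are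
    zero.\<close>
  have lim: "((\<lambda>s. p * ln (s * p + q) - p * ln s) \<longlongrightarrow> p * log0 p) at_top"
    if "0 \<le> p" "0 < q" for p q :: real
  proof (cases "p = 0")
    case False
    hence p: "p > 0" using that by simp
    have "((\<lambda>s. p + q / s) \<longlongrightarrow> p + 0) at_top"
      by (intro tendsto_add tendsto_const real_tendsto_divide_at_top[OF tendsto_const filterlim_ident])
    hence "((\<lambda>s. p * ln (p + q / s)) \<longlongrightarrow> p * ln p) at_top"
      using p by (intro tendsto_intros) auto
    moreover have "eventually (\<lambda>s. p * ln (p + q / s) = p * ln (s * p + q) - p * ln s) at_top"
      using eventually_gt_at_top[of 0]
    proof eventually_elim
      case (elim s)
      have "p + q / s = (s * p + q) / s" using elim by (simp add: field_simps)
      moreover have "s * p + q > 0" using elim p that by (simp add: add_pos_pos)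
      ultimately show ?case using elim by (simp add: ln_div right_diff_distrib)
    qed
    ultimately show ?thesis using p by (simp add: log0_def tendsto_cong)
  qed simp
  have "((\<lambda>s. (\<Sum>t\<in>T. a t * (p t * ln (s * p t + q t) - p t * ln s))
         - (\<Sum>t\<in>T'. a' t * (p' t * ln (s * p' t + q' t) - p' t * ln s))) \<longlongrightarrow>
      (\<Sum>t\<in>T. a t * (p t * log0 (p t))) - (\<Sum>t\<in>T'. a' t * (p' t * log0 (p' t)))) at_top"
    by (intro tendsto_diff tendsto_sum tendsto_mult_left lim p q p' q')
  \<comment> \<open>Equal total mass makes the two \<open>ln s\<close> corrections cancel, so the
    regularised difference is \<open>F - F'\<close> itself.\<close>
  moreover have "(\<Sum>t\<in>T. a t * (p t * ln (s * p t + q t) - p t * ln s))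
         - (\<Sum>t\<in>T'. a' t * (p' t * ln (s * p' t + q' t) - p' t * ln s)) = F s - F' s" for s
    unfolding F_def F'_def right_diff_distrib sum_subtractf
    using arg_cong[OF mass, of "\<lambda>x. x * ln s"] by (simp add: sum_distrib_right mult.assoc)
  ultimately have "((\<lambda>s. F s - F' s) \<longlongrightarrow>
      (\<Sum>t\<in>T. a t * (p t * log0 (p t))) - (\<Sum>t\<in>T'. a' t * (p' t * log0 (p' t)))) at_top"
    by (simp only:)
  moreover have "eventually (\<lambda>s. F 0 - F' 0 \<le> F s - F' s) at_top"
    by (rule eventually_mono[OF eventually_ge_at_top[of 0]]) (rule mono)
  ultimately have "F 0 - F' 0 \<le> (\<Sum>t\<in>T. a t * (p t * log0 (p t))) - (\<Sum>t\<in>T'. a' t * (p' t * log0 (p' t)))"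
    by (intro tendsto_lowerbound) auto
  moreover have "F 0 = (\<Sum>t\<in>T. a t * (p t * log0 (q t)))"
    unfolding F_def using q by (intro sum.cong) (auto simp: log0_def)
  moreover have "F' 0 = (\<Sum>t\<in>T'. a' t * (p' t * log0 (q' t)))"
    unfolding F'_def using q' by (intro sum.cong) (auto simp: log0_def)
  ultimately show ?thesis by (simp add: right_diff_distrib sum_subtractf)
qed

text \<open>Restricting a state along a \<open>*\<close>-homomorphism \<open>L\<close> shrinks the set of competitors in the
  variational formula.\<close>

theorem rel_ent_mono:
  fixes \<rho> \<sigma> :: "'i op" and \<rho>' \<sigma>' :: "'j op" and L :: "'j op \<Rightarrow> 'i op"
  assumes I: "finite I" and v: "spec_dec I \<rho> v p" and w: "spec_dec I \<sigma> w q"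
    and p: "\<And>k. k \<in> I \<Longrightarrow> 0 \<le> p k" and q: "\<And>k. k \<in> I \<Longrightarrow> 0 < q k"
    and J: "finite J" and v': "spec_dec J \<rho>' v' p'" and w': "spec_dec J \<sigma>' w' q'"
    and p': "\<And>k. k \<in> J \<Longrightarrow> 0 \<le> p' k" and q': "\<And>k. k \<in> J \<Longrightarrow> 0 < q' k"
    and L_mult: "\<And>Y Z i j. i \<in> I \<Longrightarrow> j \<in> I \<Longrightarrow> L (op_mult J Y Z) i j = op_mult I (L Y) (L Z) i j"
    and L_adj: "\<And>Y. L (op_adj Y) = op_adj (L Y)"
    and L_rho: "\<And>Y. op_trace I (op_mult I \<rho> (L Y)) = op_trace J (op_mult J \<rho>' Y)"
    and L_sigma: "\<And>Y. op_trace I (op_mult I \<sigma> (L Y)) = op_trace J (op_mult J \<sigma>' Y)"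
    and tr: "op_trace I \<rho> = op_trace J \<rho>'"
  shows "rel_ent J \<rho>' \<sigma>' \<le> rel_ent I \<rho> \<sigma>"
proof -
  \<comment> \<open>Multiplicativity of \<open>L\<close> is assumed only for indices in
    \<open>I\<close>, which is all that a trace over \<open>I\<close> sees.\<close>
  have trace_cong: "op_trace I (op_mult I A (op_mult I (L Y) (L Z))) = op_trace I (op_mult I A (L (op_mult J Y Z)))"
    for A Y Z
    unfolding op_trace_def op_mult_def[of I A] by (intro sum.cong refl) (simp add: L_mult)
  have le: "(\<Sum>k\<in>J. \<Sum>l\<in>J. (cmod (ip J (w' l) (v' k)))\<^sup>2 * (p' k * p' k / (s * p' k + q' l)))
     \<le> (\<Sum>k\<in>I. \<Sum>l\<in>I. (cmod (ip I (w l) (v k)))\<^sup>2 * (p k * p k / (s * p k + q l)))" if s: "0 \<le> s" for s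
  proof -
    obtain Y where Y: "resolvent_functional J \<rho>' \<sigma>' s Y =
      (\<Sum>k\<in>J. \<Sum>l\<in>J. (cmod (ip J (w' l) (v' k)))\<^sup>2 * (p' k * p' k / (s * p' k + q' l)))"
      using resolvent_functional_attained[OF J v' w' p' q' s] by blast
    have "resolvent_functional J \<rho>' \<sigma>' s Y = resolvent_functional I \<rho> \<sigma> s (L Y)"
      unfolding resolvent_functional_def L_adj[symmetric] trace_cong L_rho L_sigma ..
    also have "\<dots> \<le> (\<Sum>k\<in>I. \<Sum>l\<in>I. (cmod (ip I (w l) (v k)))\<^sup>2 * (p k * p k / (s * p k + q l)))"
      by (rule resolvent_functional_le[OF I v w p q s])
    finally show ?thesis unfolding Y .
  qed
  \<comment> \<open>Overlaps sum to one, so both masses are sums of eigenvalues, that is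
    traces.\<close>
  have mass: "(\<Sum>k\<in>J. \<Sum>l\<in>J. (cmod (ip J (w' l) (v' k)))\<^sup>2 * p' k)
      = (\<Sum>k\<in>I. \<Sum>l\<in>I. (cmod (ip I (w l) (v k)))\<^sup>2 * p k)"
  proof -
    have "(\<Sum>k\<in>J. p' k) = (\<Sum>k\<in>I. p k)"
      using tr unfolding trace_spec_dec[OF I v] trace_spec_dec[OF J v'] of_real_eq_iff by simp
    thus ?thesis unfolding sum_distrib_right[symmetric]
      using overlap_sum[OF I spec_dec_orthonormal[OF v] spec_dec_orthonormal[OF w]]
        overlap_sum[OF J spec_dec_orthonormal[OF v'] spec_dec_orthonormal[OF w']] by simp
  qed
  have "(\<Sum>t\<in>J \<times> J. (case t of (k, l) \<Rightarrow> (cmod (ip J (w' l) (v' k)))\<^sup>2)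
          * (p' (fst t) * (log0 (p' (fst t)) - log0 (q' (snd t)))))
      \<le> (\<Sum>t\<in>I \<times> I. (case t of (k, l) \<Rightarrow> (cmod (ip I (w l) (v k)))\<^sup>2)
          * (p (fst t) * (log0 (p (fst t)) - log0 (q (snd t)))))"
    by (rule relative_entropy_sum_le)
      (use p q p' q' le mass in \<open>auto simp: sum.cartesian_product split_beta\<close>)
  thus ?thesis
    unfolding rel_ent_spec_dec[OF I v w] rel_ent_spec_dec[OF J v' w']
    by (simp add: sum.cartesian_product split_beta)
qed

section \<open>Configurations, reduced operators and lifted operators\<close>

lemma finite_confs: "finite A \<Longrightarrow> finite (confs A d)"
  unfolding confs_def by (intro finite_PiE) auto

lemma restrict_in_confs: "c \<in> confs T d \<Longrightarrow> A \<subseteq> T \<Longrightarrow> restrict c A \<in> confs A d"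
  by (auto simp: confs_def PiE_iff)

lemma merge_in_confs:
  "A \<subseteq> T \<Longrightarrow> a \<in> confs A d \<Longrightarrow> c \<in> confs (T - A) d \<Longrightarrow> merge_conf A a c \<in> confs T d"
  by (auto simp: confs_def PiE_iff merge_conf_def extensional_def)

lemma restrict_merge: "a \<in> confs A d \<Longrightarrow> restrict (merge_conf A a c) A = a"
  by (auto simp: confs_def PiE_iff merge_conf_def extensional_def restrict_def)

lemma restrict_merge_compl: "c \<in> confs (T - A) d \<Longrightarrow> restrict (merge_conf A a c) (T - A) = c"
  by (auto simp: confs_def PiE_iff merge_conf_def extensional_def restrict_def)

lemma merge_restrict:
  "c \<in> confs T d \<Longrightarrow> merge_conf A (restrict c A) (restrict c (T - A)) = c"
  by (auto simp: confs_def PiE_iff merge_conf_def extensional_def restrict_def)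

lemma confs_mergeE:
  assumes "c \<in> confs T d" "A \<subseteq> T"
  obtains a b where "a \<in> confs A d" "b \<in> confs (T - A) d" "c = merge_conf A a b"
  using assms merge_restrict[OF assms(1), of A] restrict_in_confs[OF assms(1)] by (metis Diff_subset)

lemma merge_eq_iff:
  assumes "a \<in> confs A d" "b \<in> confs A d" "c \<in> confs (T - A) d" "c' \<in> confs (T - A) d"
  shows "merge_conf A a c = merge_conf A b c' \<longleftrightarrow> a = b \<and> c = c'"
  using assms restrict_merge restrict_merge_compl by metis

lemma merge_agree_iff:
  assumes "c \<in> confs (T - A) d" "c' \<in> confs (T - A) d"
  shows "(\<forall>x\<in>T - A. merge_conf A a c x = merge_conf A b c' x) \<longleftrightarrow> c = c'"
  using assms PiE_ext[of c "T - A" _ c'] unfolding confs_def merge_conf_def by auto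

lemma sum_confs_split:
  assumes "A \<subseteq> T"
  shows "(\<Sum>c\<in>confs T d. f c) = (\<Sum>a\<in>confs A d. \<Sum>c\<in>confs (T - A) d. f (merge_conf A a c))"
  unfolding sum.cartesian_product
  by (rule sum.reindex_bij_witness[of _ "\<lambda>(a, c). merge_conf A a c" "\<lambda>c. (restrict c A, restrict c (T - A))"])
    (use assms in \<open>auto simp: merge_restrict restrict_in_confs merge_in_confs restrict_merge restrict_merge_compl\<close>)

text \<open>Naming the sites that are kept, instead of those traced out, lets successive reductions
  compose along inclusions.\<close>

definition reduced :: "('s \<Rightarrow> nat) \<Rightarrow> 's set \<Rightarrow> 's set \<Rightarrow> ('s \<Rightarrow> nat) op \<Rightarrow> ('s \<Rightarrow> nat) op" where
  "reduced d T A \<rho> = ptrace T d (T - A) \<rho>"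

lemma reduced_eq:
  "A \<subseteq> T \<Longrightarrow> reduced d T A \<rho> a b
     = (\<Sum>c\<in>confs (T - A) d. \<rho> (merge_conf A a c) (merge_conf A b c))"
  by (simp add: reduced_def ptrace_def double_diff)

lemma reduced_reduced:
  assumes "A \<subseteq> S" "S \<subseteq> T"
  shows "reduced d S A (reduced d T S \<rho>) = reduced d T A \<rho>"
proof (intro ext)
  fix a b
  have m: "merge_conf A a (merge_conf (S - A) c e) = merge_conf S (merge_conf A a c) e" for a c e :: "'a \<Rightarrow> nat"
    using assms by (auto simp: merge_conf_def fun_eq_iff)
  have TS: "T - A - (S - A) = T - S" using assms by auto
  have "reduced d T A \<rho> a b = (\<Sum>c\<in>confs (S - A) d. \<Sum>e\<in>confs (T - S) d.
      \<rho> (merge_conf S (merge_conf A a c) e) (merge_conf S (merge_conf A b c) e))"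
    unfolding reduced_eq[OF order_trans[OF assms]] using assms
    by (subst sum_confs_split[of "S - A"]) (auto simp: TS m)
  thus "reduced d S A (reduced d T S \<rho>) a b = reduced d T A \<rho> a b"
    using assms by (simp add: reduced_eq)
qed

text \<open>The sum runs over the single empty configuration, which is \<open>undefined\<close>
  everywhere. Merging with it changes nothing for \<open>a\<close> and \<open>b\<close>, because
  configurations are already \<open>undefined\<close> outside \<open>T\<close>.\<close>

lemma reduced_self:
  assumes "a \<in> confs T d" "b \<in> confs T d"
  shows "reduced d T T \<rho> a b = \<rho> a b"
proof -
  have "merge_conf T c (\<lambda>_. undefined) = c" if "c \<in> confs T d" for c
    using that by (auto simp: confs_def PiE_iff merge_conf_def extensional_def)
  thus ?thesis using assms by (simp add: reduced_eq) (simp add: confs_def)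
qed

lemma trace_reduced:
  assumes "A \<subseteq> T"
  shows "op_trace (confs A d) (reduced d T A \<rho>) = op_trace (confs T d) \<rho>"
  unfolding op_trace_def sum_confs_split[OF assms] reduced_eq[OF assms] ..

lemma reduced_hermitian:
  assumes "A \<subseteq> T" "op_hermitian (confs T d) \<rho>"
  shows "op_hermitian (confs A d) (reduced d T A \<rho>)"
proof -
  have h: "\<rho> j i = cnj (\<rho> i j)" if "i \<in> confs T d" "j \<in> confs T d" for i j
    using assms(2) that unfolding op_hermitian_def by blast
  show ?thesis unfolding op_hermitian_def reduced_eq[OF assms(1)] cnj_sum
    by (intro ballI sum.cong refl h merge_in_confs[OF assms(1)])
qed

lemma sum_delta_swap:
  assumes "finite C"
  shows "(\<Sum>b\<in>B. \<Sum>f\<in>C. if f = e then g b f else (0::complex)) = (if e \<in> C then \<Sum>b\<in>B. g b e else 0)"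
  using assms by simp

text \<open>The quadratic form of the reduced operator at \<open>\<psi>\<close> is the sum over
  basis vectors \<open>c\<close> of the traced-out factor of the form of \<open>\<rho>\<close> at
  \<open>\<psi>\<close> tensor \<open>c\<close>, the vector \<open>\<phi> c\<close> below.\<close>

lemma reduced_psd:
  assumes A: "A \<subseteq> T" and T: "finite T" and psd: "op_psd (confs T d) \<rho>"
  shows "op_psd (confs A d) (reduced d T A \<rho>)"
proof -
  have "0 \<le> Re (quad_form (confs A d) (reduced d T A \<rho>) \<psi>)" for \<psi>
  proof -
    define \<phi> where "\<phi> c = (\<lambda>i. if restrict i (T - A) = c then \<psi> (restrict i A) else 0)" for c
    have fin: "finite (confs (T - A) d)" using T by (intro finite_confs) auto
    have \<phi>: "\<phi> c (merge_conf A a e) = (if e = c then \<psi> a else 0)"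
      if "a \<in> confs A d" "e \<in> confs (T - A) d" for a c e
      using that by (simp add: \<phi>_def restrict_merge restrict_merge_compl)
    have "quad_form (confs T d) \<rho> (\<phi> c)
        = (\<Sum>a\<in>confs A d. \<Sum>b\<in>confs A d. cnj (\<psi> a) * \<rho> (merge_conf A a c) (merge_conf A b c) * \<psi> b)"
      if c: "c \<in> confs (T - A) d" for c
    proof -
      have "quad_form (confs T d) \<rho> (\<phi> c) = (\<Sum>a\<in>confs A d. \<Sum>e\<in>confs (T - A) d.
          \<Sum>b\<in>confs A d. \<Sum>f\<in>confs (T - A) d.
            if f = c then (if e = c then cnj (\<psi> a) * \<rho> (merge_conf A a e) (merge_conf A b f) * \<psi> b else 0) else 0)"
        unfolding quad_form_def sum_confs_split[OF A] by (intro sum.cong refl) (auto simp: \<phi>)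
      also have "\<dots> = (\<Sum>a\<in>confs A d. \<Sum>e\<in>confs (T - A) d. if e = c then
          (\<Sum>b\<in>confs A d. cnj (\<psi> a) * \<rho> (merge_conf A a e) (merge_conf A b c) * \<psi> b) else 0)"
        using fin c by (intro sum.cong refl) (auto simp: sum_delta_swap)
      finally show ?thesis using fin c by simp
    qed
    hence "(\<Sum>c\<in>confs (T - A) d. quad_form (confs T d) \<rho> (\<phi> c)) = (\<Sum>c\<in>confs (T - A) d. \<Sum>a\<in>confs A d.
        \<Sum>b\<in>confs A d. cnj (\<psi> a) * \<rho> (merge_conf A a c) (merge_conf A b c) * \<psi> b)" by simp
    also have "\<dots> = (\<Sum>a\<in>confs A d. \<Sum>b\<in>confs A d. \<Sum>c\<in>confs (T - A) d.
        cnj (\<psi> a) * \<rho> (merge_conf A a c) (merge_conf A b c) * \<psi> b)"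
      by (subst sum.swap, rule sum.cong[OF refl], rule sum.swap)
    also have "\<dots> = quad_form (confs A d) (reduced d T A \<rho>) \<psi>"
      unfolding quad_form_def reduced_eq[OF A] sum_distrib_left sum_distrib_right ..
    finally have "quad_form (confs A d) (reduced d T A \<rho>) \<psi>
        = (\<Sum>c\<in>confs (T - A) d. quad_form (confs T d) \<rho> (\<phi> c))" by simp
    thus ?thesis using psd unfolding op_psd_def by (auto intro: sum_nonneg)
  qed
  thus ?thesis using psd reduced_hermitian[OF A] unfolding op_psd_def by blast
qed

text \<open>\<open>lift_op T A Y\<close> is the operator \<open>Y \<otimes> 1\<close> on the sites \<open>T\<close>, with \<open>Y\<close> acting on \<open>A\<close>.\<close>

definition lift_op :: "'s set \<Rightarrow> 's set \<Rightarrow> ('s \<Rightarrow> nat) op \<Rightarrow> ('s \<Rightarrow> nat) op" where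
  "lift_op T A Y = (\<lambda>a b. if \<forall>x\<in>T - A. a x = b x then Y (restrict a A) (restrict b A) else 0)"

lemma lift_op_merge:
  assumes "a \<in> confs A d" "b \<in> confs A d" "c \<in> confs (T - A) d" "c' \<in> confs (T - A) d"
  shows "lift_op T A Y (merge_conf A a c) (merge_conf A b c') = (if c = c' then Y a b else 0)"
  unfolding lift_op_def merge_agree_iff[OF assms(3,4)] using assms by (simp add: restrict_merge)

lemma lift_op_adj: "lift_op T A (op_adj Y) = op_adj (lift_op T A Y)"
proof (intro ext)
  fix a b :: "'a \<Rightarrow> nat"
  have "(\<forall>x\<in>T - A. a x = b x) = (\<forall>x\<in>T - A. b x = a x)" by (intro ball_cong refl) (rule eq_commute)
  thus "lift_op T A (op_adj Y) a b = op_adj (lift_op T A Y) a b"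
    unfolding lift_op_def op_adj_def by (simp only: if_distrib[of cnj] complex_cnj_zero)
qed

lemma sum_lift_op_merge:
  assumes A: "A \<subseteq> T" "finite T" and a: "a \<in> confs A d" and c: "c \<in> confs (T - A) d"
  shows "(\<Sum>k\<in>confs T d. lift_op T A Y k (merge_conf A a c) * g k)
      = (\<Sum>b\<in>confs A d. Y b a * g (merge_conf A b c))"
proof -
  have fin: "finite (confs (T - A) d)" using A by (intro finite_confs) auto
  have "(\<Sum>k\<in>confs T d. lift_op T A Y k (merge_conf A a c) * g k)
    = (\<Sum>b\<in>confs A d. \<Sum>f\<in>confs (T - A) d. if f = c then Y b a * g (merge_conf A b f) else 0)"
    unfolding sum_confs_split[OF A(1)] by (intro sum.cong refl) (simp add: lift_op_merge a c)
  thus ?thesis using fin c by (simp add: sum_delta_swap)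
qed

text \<open>The partial trace is dual to tensoring with the identity. In this form it supplies the
  trace hypotheses of \<open>rel_ent_mono\<close> for \<open>L = lift_op T R\<close>.\<close>

lemma trace_mult_lift_op:
  assumes A: "A \<subseteq> T" "finite T"
  shows "op_trace (confs T d) (op_mult (confs T d) \<rho> (lift_op T A Y))
       = op_trace (confs A d) (op_mult (confs A d) (reduced d T A \<rho>) Y)"
proof -
  have "op_trace (confs T d) (op_mult (confs T d) \<rho> (lift_op T A Y))
    = (\<Sum>a\<in>confs A d. \<Sum>c\<in>confs (T - A) d. \<Sum>b\<in>confs A d. Y b a * \<rho> (merge_conf A a c) (merge_conf A b c))"
    unfolding op_trace_def op_mult_def
      sum_confs_split[OF A(1), where f = "\<lambda>i. \<Sum>k\<in>confs T d. \<rho> i k * lift_op T A Y k i"]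
    by (rule sum.cong[OF refl], rule sum.cong[OF refl]) (simp add: sum_lift_op_merge[OF A] mult.commute[of "\<rho> _ _"])
  also have "\<dots> = (\<Sum>a\<in>confs A d. \<Sum>b\<in>confs A d. \<Sum>c\<in>confs (T - A) d. Y b a * \<rho> (merge_conf A a c) (merge_conf A b c))"
    by (rule sum.cong[OF refl], rule sum.swap)
  finally show ?thesis
    unfolding op_trace_def op_mult_def reduced_eq[OF A(1)] sum_distrib_right by (simp only: mult.commute)
qed

lemma lift_op_mult:
  assumes A: "A \<subseteq> T" "finite T" and ij: "i \<in> confs T d" "j \<in> confs T d"
  shows "lift_op T A (op_mult (confs A d) Y Z) i j = op_mult (confs T d) (lift_op T A Y) (lift_op T A Z) i j"
proof -
  obtain a c where i: "a \<in> confs A d" "c \<in> confs (T - A) d" "i = merge_conf A a c"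
    using confs_mergeE[OF ij(1) A(1)] by blast
  obtain b c' where j: "b \<in> confs A d" "c' \<in> confs (T - A) d" "j = merge_conf A b c'"
    using confs_mergeE[OF ij(2) A(1)] by blast
  have "op_mult (confs T d) (lift_op T A Y) (lift_op T A Z) i j
     = (\<Sum>k\<in>confs T d. lift_op T A Z k (merge_conf A b c') * lift_op T A Y i k)"
    unfolding op_mult_def j(3) by (simp add: mult.commute)
  also have "\<dots> = (\<Sum>e\<in>confs A d. Z e b * (if c = c' then Y a e else 0))"
    unfolding sum_lift_op_merge[OF A j(1,2)] i(3)
    by (intro sum.cong refl) (simp add: lift_op_merge[OF i(1) _ i(2) j(2)])
  also have "\<dots> = lift_op T A (op_mult (confs A d) Y Z) i j"
    unfolding i(3) j(3) lift_op_merge[OF i(1) j(1) i(2) j(2)] op_mult_def by (simp add: mult.commute)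
  finally show ?thesis by simp
qed

text \<open>Viewing the family \<open>w\<close> as a kernel, \<open>lift_op T A w\<close> is the eigenbasis \<open>w_a \<otimes> e_c\<close>.\<close>

lemma spec_dec_lift_op:
  assumes A: "A \<subseteq> T" "finite T" and w: "spec_dec (confs A d) \<tau> w q"
  shows "spec_dec (confs T d) (lift_op T A \<tau>) (lift_op T A w) (\<lambda>k. q (restrict k A))"
  unfolding spec_dec_def
proof (intro conjI ballI)
  note on = spec_dec_orthonormal[OF w, unfolded orthonormal_def]
  fix k l assume kl: "k \<in> confs T d" "l \<in> confs T d"
  obtain a c where k: "a \<in> confs A d" "c \<in> confs (T - A) d" "k = merge_conf A a c"
    using confs_mergeE[OF kl(1) A(1)] by blast
  obtain b c' where l: "b \<in> confs A d" "c' \<in> confs (T - A) d" "l = merge_conf A b c'"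
    using confs_mergeE[OF kl(2) A(1)] by blast
  \<comment> \<open>The conjugated entry is rewritten as an entry of the lifted adjoint, so that
    \<open>sum_lift_op_merge\<close> can collapse the sum to \<open>A\<close>.\<close>
  have "(\<Sum>i\<in>confs T d. cnj (lift_op T A w k i) * lift_op T A w l i)
     = (\<Sum>i\<in>confs T d. lift_op T A (op_adj w) i (merge_conf A a c) * lift_op T A w l i)"
    unfolding lift_op_adj k(3) unfolding op_adj_def ..
  also have "\<dots> = (\<Sum>e\<in>confs A d. op_adj w e a * (if c' = c then w b e else 0))"
    unfolding sum_lift_op_merge[OF A k(1,2)] l(3)
    by (intro sum.cong refl) (simp add: lift_op_merge[OF l(1) _ l(2) k(2)])
  also have "\<dots> = (if c = c' then \<Sum>e\<in>confs A d. cnj (w a e) * w b e else 0)"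
    by (auto simp: op_adj_def)
  also have "(\<Sum>e\<in>confs A d. cnj (w a e) * w b e) = (if a = b then 1 else 0)"
    using on k l by blast
  also have "(if c = c' then (if a = b then 1 else 0) else 0) = (if k = l then 1 else (0::complex))"
    unfolding k(3) l(3) merge_eq_iff[OF k(1) l(1) k(2) l(2)] by auto
  finally show "(\<Sum>i\<in>confs T d. cnj (lift_op T A w k i) * lift_op T A w l i) = (if k = l then 1 else 0)" .
  have "(\<Sum>m\<in>confs T d. complex_of_real (q (restrict m A)) * lift_op T A w m k * cnj (lift_op T A w m l))
     = (\<Sum>m\<in>confs T d. lift_op T A w m (merge_conf A a c) * (complex_of_real (q (restrict m A)) * cnj (lift_op T A w m l)))"
    unfolding k(3) by (simp add: mult_ac)
  also have "\<dots> = (\<Sum>e\<in>confs A d. w e a * (complex_of_real (q e) * (if c = c' then cnj (w e b) else 0)))"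
    unfolding sum_lift_op_merge[OF A k(1,2)] l(3)
    by (intro sum.cong refl) (simp add: lift_op_merge[OF _ l(1) k(2) l(2)] restrict_merge)
  also have "\<dots> = (if c = c' then \<Sum>e\<in>confs A d. complex_of_real (q e) * w e a * cnj (w e b) else 0)"
    by (simp add: mult_ac)
  also have "(\<Sum>e\<in>confs A d. complex_of_real (q e) * w e a * cnj (w e b)) = \<tau> a b"
    using w k l unfolding spec_dec_def by (metis (no_types, lifting))
  also have "(if c = c' then \<tau> a b else 0) = lift_op T A \<tau> k l"
    unfolding k(3) l(3) lift_op_merge[OF k(1) l(1) k(2) l(2)] ..
  finally show "lift_op T A \<tau> k l =
      (\<Sum>m\<in>confs T d. complex_of_real (q (restrict m A)) * lift_op T A w m k * cnj (lift_op T A w m l))"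
    by (rule sym)
qed

lemma spec_dec_unique:
  "spec_dec I A v lam \<Longrightarrow> spec_dec I B v lam \<Longrightarrow> i \<in> I \<Longrightarrow> j \<in> I \<Longrightarrow> A i j = B i j"
  by (simp add: spec_dec_def)

lemma spec_dec_cong:
  "(\<And>i j. i \<in> I \<Longrightarrow> j \<in> I \<Longrightarrow> A i j = B i j) \<Longrightarrow> spec_dec I A = spec_dec I B"
  by (intro ext) (simp add: spec_dec_def)

text \<open>Kernels agreeing on \<open>I\<close> have identical \<open>spec_dec\<close> predicates,
  so \<open>SOME\<close> picks the same decomposition for both.\<close>

lemma op_fun_cong:
  assumes "\<And>i j. i \<in> I \<Longrightarrow> j \<in> I \<Longrightarrow> A i j = B i j"
  shows "op_fun I f A = op_fun I f B"
proof -
  have "spec_dec I A = spec_dec I B" by (rule spec_dec_cong) (rule assms)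
  thus ?thesis by (simp add: op_fun_def)
qed

lemma trace_mult_cong:
  assumes "\<And>i j. i \<in> I \<Longrightarrow> j \<in> I \<Longrightarrow> A i j = A' i j" "\<And>i j. i \<in> I \<Longrightarrow> j \<in> I \<Longrightarrow> B i j = B' i j"
  shows "op_trace I (op_mult I A B) = op_trace I (op_mult I A' B')"
  unfolding op_trace_def op_mult_def using assms by (intro sum.cong refl) simp

lemma entropy_cong:
  assumes "\<And>i j. i \<in> I \<Longrightarrow> j \<in> I \<Longrightarrow> A i j = B i j"
  shows "entropy I A = entropy I B"
proof -
  have "op_fun I log0 A = op_fun I log0 B" by (rule op_fun_cong) (rule assms)
  thus ?thesis unfolding entropy_def using trace_mult_cong[of I A B, OF assms] by simp
qed

text \<open>Since \<open>S\<close> and \<open>R\<close> cover \<open>T\<close>, every traced-out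
  site lies in \<open>S\<close>. The trace therefore acts on \<open>\<tau>\<close> alone, and the
  identity factor outside \<open>S\<close> survives without a dimension factor.\<close>

lemma reduced_lift_op:
  assumes T: "S \<union> R = T" and ab: "a \<in> confs R d" "b \<in> confs R d"
  shows "reduced d T R (lift_op T S \<tau>) a b = lift_op R (S \<inter> R) (reduced d S (S \<inter> R) \<tau>) a b"
proof -
  have eq: "T - R = S - S \<inter> R" "T - S = R - S \<inter> R" using T by auto
  have m: "restrict (merge_conf R a c) S = merge_conf (S \<inter> R) (restrict a (S \<inter> R)) c"
    if "c \<in> confs (S - S \<inter> R) d" for a c
    using that by (auto simp: confs_def PiE_iff extensional_def merge_conf_def restrict_def)
  have g: "(\<forall>x\<in>R - S \<inter> R. merge_conf R a c x = merge_conf R b c x) \<longleftrightarrow> (\<forall>x\<in>R - S \<inter> R. a x = b x)" for c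
    by (auto simp: merge_conf_def)
  have RT: "R \<subseteq> T" using T by auto
  define P where "P \<longleftrightarrow> (\<forall>x\<in>R - S \<inter> R. a x = b x)"
  show ?thesis
    unfolding reduced_eq[OF RT] lift_op_def reduced_eq[OF Int_lower1] eq g P_def[symmetric]
    by (cases P) (simp_all add: m)
qed

section \<open>Strong subadditivity of the entropy\<close>

lemma quad_form_eigenvector:
  assumes "finite I" "spec_dec I A v lam" "k \<in> I"
  shows "quad_form I A (v k) = complex_of_real (lam k)"
proof -
  have "quad_form I A (v k) = ip I (v k) (op_app I A (v k))"
    by (simp add: quad_form_def ip_def op_app_def sum_distrib_left mult.assoc)
  also have "\<dots> = complex_of_real (lam k) * ip I (v k) (v k)" by (rule ip_spec_dec_app[OF assms])
  also have "ip I (v k) (v k) = 1"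
    using orthonormal_ip[OF spec_dec_orthonormal[OF assms(2)]] assms(3) by simp
  finally show ?thesis by simp
qed

lemma psd_eigenvalue_nonneg:
  assumes "finite I" "spec_dec I A v lam" "k \<in> I" "op_psd I A"
  shows "0 \<le> lam k"
  using quad_form_eigenvector[OF assms(1-3)] assms(4) unfolding op_psd_def by (metis Re_complex_of_real)

lemma pd_eigenvalue_pos:
  assumes fin: "finite I" and v: "spec_dec I A v lam" and k: "k \<in> I" and pd: "op_pd I A"
  shows "0 < lam k"
proof -
  have "ip I (v k) (v k) = 1" using orthonormal_ip[OF spec_dec_orthonormal[OF v] k k] by simp
  hence "\<exists>i\<in>I. v k i \<noteq> 0" unfolding ip_def by (metis (no_types, lifting) mult_zero_right sum.neutral zero_neq_one)
  hence "0 < Re (quad_form I A (v k))" using pd unfolding op_pd_def by blast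
  thus ?thesis using quad_form_eigenvector[OF fin v k] by simp
qed

definition shift_op :: "real \<Rightarrow> 'i op \<Rightarrow> 'i op" where
  "shift_op e A = (\<lambda>i j. A i j + (if i = j then complex_of_real e else 0))"

lemma spec_dec_shift_op:
  assumes fin: "finite I" and v: "spec_dec I A v lam"
  shows "spec_dec I (shift_op e A) v (\<lambda>k. lam k + e)"
proof (rule spec_decI[OF fin spec_dec_orthonormal[OF v]])
  fix k i assume k: "k \<in> I" and i: "i \<in> I"
  have "op_app I (shift_op e A) (v k) i
      = op_app I A (v k) i + (\<Sum>j\<in>I. if i = j then complex_of_real e * v k j else 0)"
    unfolding op_app_def shift_op_def sum.distrib[symmetric]
    by (intro sum.cong refl) (simp add: distrib_right)
  thus "op_app I (shift_op e A) (v k) i = complex_of_real (lam k + e) * v k i"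
    using spec_dec_eigenvector[OF fin v k i] fin i by (simp add: distrib_right)
qed

text \<open>Tracing out the identity multiplies it by the dimension of the traced-out factor, which
  is the number of its configurations.\<close>

lemma reduced_shift_op:
  assumes A: "A \<subseteq> T" and ab: "a \<in> confs A d" "b \<in> confs A d"
  shows "reduced d T A (shift_op e \<rho>) a b
     = shift_op (real (card (confs (T - A) d)) * e) (reduced d T A \<rho>) a b"
proof -
  have "merge_conf A a c = merge_conf A b c \<longleftrightarrow> a = b" if "c \<in> confs (T - A) d" for c
    using merge_eq_iff[OF ab that that] by simp
  thus ?thesis unfolding reduced_eq[OF A] shift_op_def by (simp add: sum.distrib)
qed

text \<open>Both kernels have the eigenbasis \<open>lift_op T A w\<close> with the same eigenvalues,
  so they coincide.\<close>

lemma op_fun_lift_op: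
  assumes A: "A \<subseteq> T" "finite T" and w: "spec_dec (confs A d) \<tau> w q"
    and ij: "i \<in> confs T d" "j \<in> confs T d"
  shows "op_fun (confs T d) f (lift_op T A \<tau>) i j = lift_op T A (op_fun (confs A d) f \<tau>) i j"
proof (rule spec_dec_unique[OF _ _ ij])
  have fin: "finite (confs T d)" "finite (confs A d)"
    using A finite_subset by (auto intro: finite_confs)
  show "spec_dec (confs T d) (op_fun (confs T d) f (lift_op T A \<tau>)) (lift_op T A w) (\<lambda>k. f (q (restrict k A)))"
    by (rule spec_dec_op_fun[OF fin(1) spec_dec_lift_op[OF A w]])
  show "spec_dec (confs T d) (lift_op T A (op_fun (confs A d) f \<tau>)) (lift_op T A w) (\<lambda>k. f (q (restrict k A)))"
    by (rule spec_dec_lift_op[OF A spec_dec_op_fun[OF fin(2) w]])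
qed

text \<open>The logarithm of the lifted operator is the lifted logarithm. Its trace against
  \<open>\<rho>\<close> thus only sees the reduced operator, which shares the eigenbasis
  \<open>w\<close> with its shift.\<close>

lemma rel_ent_lift_shift:
  assumes A: "A \<subseteq> T" "finite T" and w: "spec_dec (confs A d) (reduced d T A \<rho>) w q"
  shows "rel_ent (confs T d) \<rho> (lift_op T A (shift_op e (reduced d T A \<rho>)))
     = - entropy (confs T d) \<rho> - (\<Sum>k\<in>confs A d. q k * log0 (q k + e))"
proof -
  have fin: "finite (confs A d)" using A finite_subset by (auto intro: finite_confs)
  define \<tau> where "\<tau> = shift_op e (reduced d T A \<rho>)"
  have \<tau>: "spec_dec (confs A d) \<tau> w (\<lambda>k. q k + e)"
    unfolding \<tau>_def by (rule spec_dec_shift_op[OF fin w])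
  have "op_trace (confs T d) (op_mult (confs T d) \<rho> (op_fun (confs T d) log0 (lift_op T A \<tau>)))
      = op_trace (confs T d) (op_mult (confs T d) \<rho> (lift_op T A (op_fun (confs A d) log0 \<tau>)))"
    by (rule trace_mult_cong[OF refl op_fun_lift_op[OF A \<tau>]])
  also have "\<dots> = complex_of_real (\<Sum>k\<in>confs A d. q k * log0 (q k + e))"
    unfolding trace_mult_lift_op[OF A] by (rule trace_mult_same_basis[OF fin w spec_dec_op_fun[OF fin \<tau>]])
  finally show ?thesis unfolding rel_ent_eq \<tau>_def[symmetric] by simp
qed

text \<open>\<open>log0\<close> jumps at zero, but there the weight \<open>q k\<close> vanishes. At
  positive \<open>q k\<close> the logarithm is continuous.\<close>

lemma tendsto_sum_log0_shift:
  assumes q: "\<And>k. k \<in> K \<Longrightarrow> 0 \<le> q k"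
  shows "((\<lambda>e. \<Sum>k\<in>K. q k * log0 (q k + m * e)) \<longlongrightarrow> (\<Sum>k\<in>K. q k * log0 (q k))) (at_right 0)"
proof (intro tendsto_sum)
  fix k assume "k \<in> K"
  show "((\<lambda>e. q k * log0 (q k + m * e)) \<longlongrightarrow> q k * log0 (q k)) (at_right 0)"
  proof (cases "q k = 0")
    case False
    hence pos: "q k > 0" using q \<open>k \<in> K\<close> by (simp add: order.strict_iff_order)
    have "((\<lambda>e. q k + m * e) \<longlongrightarrow> q k + m * 0) (at_right 0)" by (intro tendsto_intros)
    hence lim: "((\<lambda>e. q k + m * e) \<longlongrightarrow> q k) (at_right 0)" by simp
    have "((\<lambda>e. q k * ln (q k + m * e)) \<longlongrightarrow> q k * ln (q k)) (at_right 0)"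
      using pos by (intro tendsto_intros lim) auto
    moreover have "eventually (\<lambda>e. q k * ln (q k + m * e) = q k * log0 (q k + m * e)) (at_right 0)"
      using order_tendstoD(1)[OF lim pos] by eventually_elim (simp add: log0_def)
    ultimately show ?thesis using pos by (simp add: log0_def[of "q k"] tendsto_cong)
  qed simp
qed

text \<open>Monotonicity under restriction to \<open>R\<close>, applied to \<open>\<rho>\<close> and \<open>\<rho>_S \<otimes> 1\<close>; the shift by \<open>e > 0\<close>
  makes the latter invertible and is removed in the limit.\<close>

theorem strong_subadditivity:
  assumes T: "finite T" "S \<union> R = T" and d: "\<forall>x\<in>T. 0 < d x" and psd: "op_psd (confs T d) \<rho>"
  shows "entropy (confs T d) \<rho> + entropy (confs (S \<inter> R) d) (reduced d T (S \<inter> R) \<rho>)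
     \<le> entropy (confs S d) (reduced d T S \<rho>) + entropy (confs R d) (reduced d T R \<rho>)"
proof -
  define A where "A = S \<inter> R"
  have sub: "S \<subseteq> T" "R \<subseteq> T" "A \<subseteq> T" "A \<subseteq> S" "A \<subseteq> R" using T unfolding A_def by auto
  have fins: "finite S" "finite R" "finite A" using sub T(1) finite_subset by blast+
  note fin = finite_confs[OF T(1), of d] finite_confs[OF fins(1), of d] finite_confs[OF fins(2), of d]
    finite_confs[OF fins(3), of d]
  define \<rho>S \<rho>R \<rho>A where "\<rho>S = reduced d T S \<rho>" and "\<rho>R = reduced d T R \<rho>" and "\<rho>A = reduced d T A \<rho>"
  have psds: "op_psd (confs S d) \<rho>S" "op_psd (confs R d) \<rho>R" "op_psd (confs A d) \<rho>A"
    unfolding \<rho>S_def \<rho>R_def \<rho>A_def using reduced_psd[OF _ T(1) psd] sub by auto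
  have RA: "reduced d R A \<rho>R = \<rho>A" and SA: "reduced d S A \<rho>S = \<rho>A"
    unfolding \<rho>S_def \<rho>R_def \<rho>A_def by (simp_all add: reduced_reduced sub)
  obtain v p where v: "spec_dec (confs T d) \<rho> v p"
    using spec_dec_exists[OF fin(1)] psd unfolding op_psd_def by blast
  obtain v' p' where v': "spec_dec (confs R d) \<rho>R v' p'"
    using spec_dec_exists[OF fin(3)] psds(2) unfolding op_psd_def by blast
  obtain w q where w: "spec_dec (confs S d) \<rho>S w q"
    using spec_dec_exists[OF fin(2)] psds(1) unfolding op_psd_def by blast
  obtain u r where u: "spec_dec (confs A d) \<rho>A u r"
    using spec_dec_exists[OF fin(4)] psds(3) unfolding op_psd_def by blast
  have p: "0 \<le> p k" if "k \<in> confs T d" for k using psd_eigenvalue_nonneg[OF fin(1) v that psd] .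
  have p': "0 \<le> p' k" if "k \<in> confs R d" for k using psd_eigenvalue_nonneg[OF fin(3) v' that psds(2)] .
  have q: "0 \<le> q k" if "k \<in> confs S d" for k using psd_eigenvalue_nonneg[OF fin(2) w that psds(1)] .
  have r: "0 \<le> r k" if "k \<in> confs A d" for k using psd_eigenvalue_nonneg[OF fin(4) u that psds(3)] .
  define m where "m = real (card (confs (S - A) d))"
  \<comment> \<open>Positive local dimensions give at least one configuration, so the dimension
    \<open>m\<close> of the factor traced out from \<open>S\<close> is positive and the shift
    \<open>m * e\<close> stays positive.\<close>
  have "confs (S - A) d \<noteq> {}" using d sub unfolding confs_def PiE_eq_empty_iff by fastforce
  hence m: "m > 0" unfolding m_def using finite_confs[of "S - A" d] fins by (simp add: card_gt_0_iff)
  have ineq: "- entropy (confs R d) \<rho>R - (\<Sum>k\<in>confs A d. r k * log0 (r k + m * e))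
     \<le> - entropy (confs T d) \<rho> - (\<Sum>k\<in>confs S d. q k * log0 (q k + 1 * e))" if e: "e > 0" for e
  proof -
    define \<sigma> where "\<sigma> = lift_op T S (shift_op e \<rho>S)"
    define \<sigma>' where "\<sigma>' = lift_op R A (shift_op (m * e) \<rho>A)"
    \<comment> \<open>Reducing the lifted, shifted marginal on \<open>S\<close> to \<open>R\<close>
      gives the lifted marginal on \<open>A\<close>, with its shift scaled by
      \<open>m\<close>.\<close>
    have red: "reduced d T R \<sigma> i j = \<sigma>' i j" if "i \<in> confs R d" "j \<in> confs R d" for i j
    proof -
      have "restrict i A \<in> confs A d" "restrict j A \<in> confs A d"
        using that sub restrict_in_confs by blast+
      hence "reduced d S A (shift_op e \<rho>S) (restrict i A) (restrict j A)
          = shift_op (m * e) \<rho>A (restrict i A) (restrict j A)"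
        unfolding m_def SA[symmetric] by (rule reduced_shift_op[OF sub(4)])
      thus ?thesis
        unfolding \<sigma>_def reduced_lift_op[OF T(2) that] A_def[symmetric] \<sigma>'_def
        unfolding lift_op_def by simp
    qed
    have "rel_ent (confs R d) \<rho>R \<sigma>' \<le> rel_ent (confs T d) \<rho> \<sigma>"
    proof (rule rel_ent_mono[where L = "lift_op T R"])
      show "spec_dec (confs T d) \<sigma> (lift_op T S w) (\<lambda>k. q (restrict k S) + e)"
        unfolding \<sigma>_def using spec_dec_lift_op[OF sub(1) T(1) spec_dec_shift_op[OF fin(2) w]] .
      show "spec_dec (confs R d) \<sigma>' (lift_op R A u) (\<lambda>k. r (restrict k A) + m * e)"
        unfolding \<sigma>'_def using spec_dec_lift_op[OF sub(5) fins(2) spec_dec_shift_op[OF fin(4) u]] .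
      show "0 < q (restrict k S) + e" if "k \<in> confs T d" for k
        using q[OF restrict_in_confs[OF that sub(1)]] e by simp
      show "0 < r (restrict k A) + m * e" if "k \<in> confs R d" for k
        using r[OF restrict_in_confs[OF that sub(5)]] e m by (simp add: add_nonneg_pos)
      show "op_trace (confs T d) (op_mult (confs T d) \<rho> (lift_op T R Y))
          = op_trace (confs R d) (op_mult (confs R d) \<rho>R Y)" for Y
        unfolding \<rho>R_def by (rule trace_mult_lift_op[OF sub(2) T(1)])
      show "op_trace (confs T d) (op_mult (confs T d) \<sigma> (lift_op T R Y))
          = op_trace (confs R d) (op_mult (confs R d) \<sigma>' Y)" for Y
        unfolding trace_mult_lift_op[OF sub(2) T(1)] by (rule trace_mult_cong[OF red refl])
      show "op_trace (confs T d) \<rho> = op_trace (confs R d) \<rho>R"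
        unfolding \<rho>R_def by (rule trace_reduced[OF sub(2), symmetric])
    qed (fact fin v v' p p' lift_op_mult[OF sub(2) T(1)] lift_op_adj)+
    thus ?thesis
      unfolding \<sigma>_def \<sigma>'_def
        rel_ent_lift_shift[OF sub(1) T(1), of d \<rho>, folded \<rho>S_def, OF w]
        rel_ent_lift_shift[OF sub(5) fins(2), of d \<rho>R, unfolded RA, OF u] by simp
  qed
  have "- entropy (confs R d) \<rho>R - (\<Sum>k\<in>confs A d. r k * log0 (r k))
     \<le> - entropy (confs T d) \<rho> - (\<Sum>k\<in>confs S d. q k * log0 (q k))"
  proof (rule tendsto_le[OF trivial_limit_at_right_real])
    show "((\<lambda>e. - entropy (confs T d) \<rho> - (\<Sum>k\<in>confs S d. q k * log0 (q k + 1 * e)))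
        \<longlongrightarrow> - entropy (confs T d) \<rho> - (\<Sum>k\<in>confs S d. q k * log0 (q k))) (at_right 0)"
      by (intro tendsto_diff tendsto_const tendsto_sum_log0_shift q)
    show "((\<lambda>e. - entropy (confs R d) \<rho>R - (\<Sum>k\<in>confs A d. r k * log0 (r k + m * e)))
        \<longlongrightarrow> - entropy (confs R d) \<rho>R - (\<Sum>k\<in>confs A d. r k * log0 (r k))) (at_right 0)"
      by (intro tendsto_diff tendsto_const tendsto_sum_log0_shift r)
    show "eventually (\<lambda>e. - entropy (confs R d) \<rho>R - (\<Sum>k\<in>confs A d. r k * log0 (r k + m * e))
     \<le> - entropy (confs T d) \<rho> - (\<Sum>k\<in>confs S d. q k * log0 (q k + 1 * e))) (at_right 0)"
      using eventually_at_right_less by eventually_elim (rule ineq)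
  qed
  thus ?thesis
    unfolding A_def[symmetric] \<rho>S_def[symmetric] \<rho>R_def[symmetric] \<rho>A_def[symmetric]
      entropy_spec_dec[OF fin(2) w] entropy_spec_dec[OF fin(4) u] by simp
qed

text \<open>In the induction step the new term is bounded by the entropy gained from
  \<open>A\<close> to \<open>insert x A\<close>. This is strong subadditivity for
  \<open>T - {x}\<close> and \<open>insert x A\<close>, whose union is \<open>T\<close> and whose
  intersection is \<open>A\<close>.\<close>

lemma sum_conditional_entropy_le:
  assumes T: "finite T" and d: "\<forall>x\<in>T. 0 < d x" and st: "is_state (confs T d) \<rho>" and A: "A \<subseteq> T"
  shows "(\<Sum>x\<in>A. entropy (confs T d) \<rho> - entropy (confs (T - {x}) d) (reduced d T (T - {x}) \<rho>))
     \<le> entropy (confs A d) (reduced d T A \<rho>)"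
proof -
  have psd: "op_psd (confs T d) \<rho>" and tr: "op_trace (confs T d) \<rho> = 1"
    using st unfolding is_state_def by auto
  have "finite A" using A T finite_subset by blast
  from this A show ?thesis
  proof (induction A rule: finite_induct)
    case empty
    have fin: "finite (confs {} d)" by (simp add: finite_confs)
    have "op_hermitian (confs {} d) (reduced d T {} \<rho>)"
      using reduced_psd[OF _ T psd, of "{}"] unfolding op_psd_def by simp
    then obtain v p where v: "spec_dec (confs {} d) (reduced d T {} \<rho>) v p"
      using spec_dec_exists[OF fin] by blast
    have "complex_of_real (\<Sum>k\<in>confs {} d. p k) = 1"
      unfolding trace_spec_dec[OF fin v, symmetric] trace_reduced[OF empty_subsetI] tr ..
    \<comment> \<open>No sites means a one-dimensional space, where unit trace forces the only
      eigenvalue to be \<open>1\<close>, with logarithm zero.\<close>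
    hence "p (\<lambda>_. undefined) = 1" by (simp add: confs_def)
    hence "entropy (confs {} d) (reduced d T {} \<rho>) = 0"
      unfolding entropy_spec_dec[OF fin v] by (simp add: confs_def log0_def)
    thus ?case by simp
  next
    case (insert x A)
    have "(T - {x}) \<union> insert x A = T" "(T - {x}) \<inter> insert x A = A" using insert by auto
    with strong_subadditivity[OF T this(1) d psd] insert show ?case by simp
  qed
qed

section \<open>Product states\<close>

lemma sum_confs_prod:
  fixes f :: "'s \<Rightarrow> nat \<Rightarrow> 'a::comm_semiring_1"
  assumes "finite A"
  shows "(\<Sum>k\<in>confs A d. \<Prod>x\<in>A. f x (k x)) = (\<Prod>x\<in>A. \<Sum>j<d x. f x j)"
  unfolding confs_def using assms by (intro prod_sum_PiE[symmetric]) auto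

text \<open>Read as a kernel, \<open>tensor_op A W\<close> lists the product eigenvectors. Each sum
  over configurations of a product factors into one-site sums by
  \<open>sum_confs_prod\<close>.\<close>

lemma spec_dec_tensor_op:
  assumes A: "finite A" and W: "\<And>x. x \<in> A \<Longrightarrow> spec_dec {..<d x} (sig x) (W x) (q x)"
  shows "spec_dec (confs A d) (tensor_op A sig) (tensor_op A W) (\<lambda>k. \<Prod>x\<in>A. q x (k x))"
  unfolding spec_dec_def
proof (intro conjI ballI)
  fix k l assume kl: "k \<in> confs A d" "l \<in> confs A d"
  have lt: "k x < d x" "l x < d x" if "x \<in> A" for x
    using kl that by (auto simp: confs_def PiE_iff)
  have "(\<Sum>i\<in>confs A d. cnj (tensor_op A W k i) * tensor_op A W l i)
     = (\<Sum>i\<in>confs A d. \<Prod>x\<in>A. cnj (W x (k x) (i x)) * W x (l x) (i x))"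
    by (simp add: tensor_op_def prod.distrib)
  also have "\<dots> = (\<Prod>x\<in>A. \<Sum>j<d x. cnj (W x (k x) j) * W x (l x) j)" by (rule sum_confs_prod[OF A])
  also have "\<dots> = (\<Prod>x\<in>A. if k x = l x then 1 else 0)"
    using W lt unfolding spec_dec_def by (intro prod.cong refl) blast
  also have "\<dots> = (if k = l then 1 else 0)"
  proof (cases "k = l")
    case False
    then obtain x where "x \<in> A" "k x \<noteq> l x"
      using kl PiE_ext[of k A "\<lambda>x. {..<d x}" l] unfolding confs_def by blast
    hence "(\<Prod>x\<in>A. if k x = l x then 1 else (0::complex)) = 0" using A by (intro prod_zero) auto
    thus ?thesis using False by simp
  qed simp
  finally show "(\<Sum>i\<in>confs A d. cnj (tensor_op A W k i) * tensor_op A W l i) = (if k = l then 1 else 0)" .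
  have "tensor_op A sig k l = (\<Prod>x\<in>A. \<Sum>j<d x. complex_of_real (q x j) * W x j (k x) * cnj (W x j (l x)))"
    unfolding tensor_op_def using W lt unfolding spec_dec_def by (intro prod.cong refl) blast
  also have "\<dots> = (\<Sum>m\<in>confs A d. \<Prod>x\<in>A. complex_of_real (q x (m x)) * W x (m x) (k x) * cnj (W x (m x) (l x)))"
    by (rule sum_confs_prod[OF A, symmetric])
  finally show "tensor_op A sig k l = (\<Sum>m\<in>confs A d. complex_of_real (\<Prod>x\<in>A. q x (m x))
      * tensor_op A W m k * cnj (tensor_op A W m l))"
    by (simp add: tensor_op_def prod.distrib)
qed

definition id_op :: "'i op" where
  "id_op = (\<lambda>i j. if i = j then 1 else 0)"

lemma spec_dec_id_op:
  assumes "finite I" "orthonormal I I v"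
  shows "spec_dec I id_op v (\<lambda>_. 1)"
  using assms orthonormal_complete[OF assms] unfolding spec_dec_def id_op_def orthonormal_def by auto

text \<open>Writing the one-site logarithm as a family of factors, with identities elsewhere, makes
  it a product operator to which the \<open>tensor_op\<close> lemmas apply.\<close>

definition site_log :: "('s \<Rightarrow> nat) \<Rightarrow> ('s \<Rightarrow> nat op) \<Rightarrow> 's \<Rightarrow> 's \<Rightarrow> nat op" where
  "site_log d sig x = (\<lambda>z. if z = x then op_fun {..<d x} log0 (sig x) else id_op)"

text \<open>All the one-site terms are diagonal in the product eigenbasis of the state. On its
  eigenvalues the claim is that the logarithm of a product is a sum, where positive definiteness
  makes \<open>log0\<close> equal to \<open>ln\<close>.\<close>

lemma op_fun_log_tensor_op:
  assumes A: "finite A" and pd: "\<And>x. x \<in> A \<Longrightarrow> op_pd {..<d x} (sig x)"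
    and ij: "i \<in> confs A d" "j \<in> confs A d"
  shows "op_fun (confs A d) log0 (tensor_op A sig) i j = (\<Sum>x\<in>A. tensor_op A (site_log d sig x) i j)"
proof -
  have "\<forall>x\<in>A. \<exists>v lam. spec_dec {..<d x} (sig x) v lam"
    using spec_dec_exists[of "{..<d _}"] pd unfolding op_pd_def by blast
  then obtain W q where W: "\<And>x. x \<in> A \<Longrightarrow> spec_dec {..<d x} (sig x) (W x) (q x)" by metis
  have q: "0 < q x m" if "x \<in> A" "m < d x" for x m
    using pd_eigenvalue_pos[OF _ W[OF that(1)] _ pd[OF that(1)], of m] that(2) by simp
  have site: "spec_dec (confs A d) (tensor_op A (site_log d sig x)) (tensor_op A W)
     (\<lambda>k. \<Prod>z\<in>A. (if z = x then \<lambda>m. log0 (q x m) else (\<lambda>_. 1)) (k z))" for x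
  proof (rule spec_dec_tensor_op[OF A])
    fix z assume z: "z \<in> A"
    show "spec_dec {..<d z} (site_log d sig x z) (W z) (if z = x then \<lambda>m. log0 (q x m) else (\<lambda>_. 1))"
      using spec_dec_op_fun[OF _ W[OF z], of log0]
        spec_dec_id_op[OF _ spec_dec_orthonormal[OF W[OF z]]]
      by (auto simp: site_log_def)
  qed
  have prod: "(\<Prod>z\<in>A. (if z = x then \<lambda>m. log0 (q x m) else (\<lambda>_. 1)) (k z)) = log0 (q x (k x))"
    if "x \<in> A" for x and k :: "'a \<Rightarrow> nat"
  proof -
    have "(\<Prod>z\<in>A. (if z = x then \<lambda>m. log0 (q x m) else (\<lambda>_. 1)) (k z))
        = (\<Prod>z\<in>A. if z = x then log0 (q x (k x)) else 1)" by (intro prod.cong) auto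
    thus ?thesis using A that by simp
  qed
  have log: "log0 (\<Prod>x\<in>A. q x (k x)) = (\<Sum>x\<in>A. log0 (q x (k x)))" if "k \<in> confs A d" for k
  proof -
    have pos: "0 < q x (k x)" if "x \<in> A" for x
      using q[OF that] \<open>k \<in> confs A d\<close> that by (auto simp: confs_def PiE_iff)
    hence "0 < (\<Prod>x\<in>A. q x (k x))" by (intro prod_pos) auto
    moreover have "ln (\<Prod>x\<in>A. q x (k x)) = (\<Sum>x\<in>A. ln (q x (k x)))"
      using A pos by (intro ln_prod) (auto simp: less_imp_neq[symmetric])
    ultimately show ?thesis using pos by (simp add: log0_def)
  qed
  have sd: "spec_dec (confs A d) (tensor_op A sig) (tensor_op A W) (\<lambda>k. \<Prod>x\<in>A. q x (k x))"
    by (rule spec_dec_tensor_op[OF A W])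
  have "op_fun (confs A d) log0 (tensor_op A sig) i j = (\<Sum>k\<in>confs A d.
      complex_of_real (log0 (\<Prod>x\<in>A. q x (k x))) * tensor_op A W k i * cnj (tensor_op A W k j))"
    using spec_dec_op_fun[OF finite_confs[OF A] sd, of log0] ij
    unfolding spec_dec_def by blast
  also have "\<dots> = (\<Sum>k\<in>confs A d. \<Sum>x\<in>A.
      complex_of_real (log0 (q x (k x))) * tensor_op A W k i * cnj (tensor_op A W k j))"
    by (intro sum.cong refl) (simp add: log sum_distrib_right)
  also have "\<dots> = (\<Sum>x\<in>A. \<Sum>k\<in>confs A d.
      complex_of_real (log0 (q x (k x))) * tensor_op A W k i * cnj (tensor_op A W k j))"
    by (rule sum.swap)
  also have "\<dots> = (\<Sum>x\<in>A. tensor_op A (site_log d sig x) i j)"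
  proof (rule sum.cong[OF refl])
    fix x assume x: "x \<in> A"
    have "tensor_op A (site_log d sig x) i j = (\<Sum>k\<in>confs A d.
        complex_of_real (\<Prod>z\<in>A. (if z = x then \<lambda>m. log0 (q x m) else (\<lambda>_. 1)) (k z))
        * tensor_op A W k i * cnj (tensor_op A W k j))"
      using site[of x] ij unfolding spec_dec_def by blast
    thus "(\<Sum>k\<in>confs A d. complex_of_real (log0 (q x (k x))) * tensor_op A W k i * cnj (tensor_op A W k j))
        = tensor_op A (site_log d sig x) i j"
      unfolding prod[OF x] by simp
  qed
  finally show ?thesis .
qed

lemma lift_op_tensor_op:
  assumes "finite T" "y \<in> T" "M y = id_op"
  shows "lift_op T (T - {y}) (tensor_op (T - {y}) M) = tensor_op T M"
proof (intro ext)
  fix i j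
  have "T - (T - {y}) = {y}" using assms(2) by auto
  thus "lift_op T (T - {y}) (tensor_op (T - {y}) M) i j = tensor_op T M i j"
    unfolding tensor_op_def prod.remove[OF assms(1,2)] assms(3) id_op_def lift_op_def by simp
qed

text \<open>The factor at \<open>y\<close> is summed to its trace, which is one, and the other
  factors do not depend on the summed configuration.\<close>

lemma reduced_tensor_op:
  assumes T: "finite T" "y \<in> T" and tr: "op_trace {..<d y} (sig y) = 1"
  shows "reduced d T (T - {y}) (tensor_op T sig) = tensor_op (T - {y}) sig"
proof (intro ext)
  fix a b :: "'a \<Rightarrow> nat"
  have y: "T - (T - {y}) = {y}" using T by auto
  have "reduced d T (T - {y}) (tensor_op T sig) a b
     = (\<Sum>c\<in>confs {y} d. (\<Prod>x\<in>{y}. sig x (c x) (c x)) * tensor_op (T - {y}) sig a b)"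
    unfolding reduced_eq[OF Diff_subset] y tensor_op_def prod.remove[OF T]
    by (intro sum.cong refl arg_cong2[where f = "(*)"] prod.cong) (auto simp: merge_conf_def)
  also have "\<dots> = tensor_op (T - {y}) sig a b"
    unfolding sum_distrib_right[symmetric]
    using sum_confs_prod[of "{y}" "\<lambda>x j. sig x j j" d] tr by (simp add: op_trace_def)
  finally show "reduced d T (T - {y}) (tensor_op T sig) a b = tensor_op (T - {y}) sig a b" .
qed

lemma rel_ent_tensor_op:
  assumes A: "finite A" and pd: "\<And>x. x \<in> A \<Longrightarrow> op_pd {..<d x} (sig x)"
  shows "rel_ent (confs A d) \<rho> (tensor_op A sig) = - entropy (confs A d) \<rho>
     - (\<Sum>x\<in>A. Re (op_trace (confs A d) (op_mult (confs A d) \<rho> (tensor_op A (site_log d sig x)))))"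
proof -
  have "op_trace (confs A d) (op_mult (confs A d) \<rho> (op_fun (confs A d) log0 (tensor_op A sig)))
     = op_trace (confs A d) (op_mult (confs A d) \<rho> (\<lambda>i j. \<Sum>x\<in>A. tensor_op A (site_log d sig x) i j))"
    by (rule trace_mult_cong[OF refl op_fun_log_tensor_op[OF A pd]])
  also have "\<dots> = (\<Sum>i\<in>confs A d. \<Sum>k\<in>confs A d. \<Sum>x\<in>A. \<rho> i k * tensor_op A (site_log d sig x) k i)"
    unfolding op_trace_def op_mult_def sum_distrib_left ..
  also have "\<dots> = (\<Sum>x\<in>A. op_trace (confs A d) (op_mult (confs A d) \<rho> (tensor_op A (site_log d sig x))))"
    unfolding op_trace_def op_mult_def by (subst (2) sum.swap, subst sum.swap) (rule refl)
  finally show ?thesis unfolding rel_ent_eq by simp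
qed

text \<open>For \<open>z\<close> different from \<open>x\<close>, the operator
  \<open>site_log d sig z\<close> is the identity at \<open>x\<close>, so its expectation is the
  same in \<open>\<rho>\<close> and in the reduced state. Those terms cancel and only the one at
  \<open>x\<close> remains.\<close>

lemma rel_ent_site_tensor_op:
  assumes T: "finite T" and x: "x \<in> T" and sig: "\<And>x. x \<in> T \<Longrightarrow> is_full_rank_state {..<d x} (sig x)"
  shows "rel_ent_site T d x \<rho> (tensor_op T sig)
     = entropy (confs (T - {x}) d) (reduced d T (T - {x}) \<rho>) - entropy (confs T d) \<rho>
       - Re (op_trace (confs T d) (op_mult (confs T d) \<rho> (tensor_op T (site_log d sig x))))"
proof -
  have pd: "op_pd {..<d z} (sig z)" if "z \<in> T" for z
    using sig[OF that] unfolding is_full_rank_state_def by blast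
  have tr: "op_trace {..<d x} (sig x) = 1" using sig[OF x] unfolding is_full_rank_state_def by blast
  have red: "ptrace T d {x} \<rho>' = reduced d T (T - {x}) \<rho>'" for \<rho>'
    unfolding reduced_def using x by (simp add: double_diff)
  have site: "op_trace (confs (T - {x}) d) (op_mult (confs (T - {x}) d) (reduced d T (T - {x}) \<rho>)
        (tensor_op (T - {x}) (site_log d sig z)))
     = op_trace (confs T d) (op_mult (confs T d) \<rho> (tensor_op T (site_log d sig z)))" if "z \<in> T - {x}" for z
  proof -
    have "site_log d sig z x = id_op" using that by (auto simp: site_log_def)
    from lift_op_tensor_op[OF T x, of "site_log d sig z", OF this]
    show ?thesis using trace_mult_lift_op[OF Diff_subset T, of d \<rho> "{x}"] by metis
  qed
  have "rel_ent (confs (T - {x}) d) (reduced d T (T - {x}) \<rho>) (tensor_op (T - {x}) sig)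
     = - entropy (confs (T - {x}) d) (reduced d T (T - {x}) \<rho>)
       - (\<Sum>z\<in>T - {x}. Re (op_trace (confs T d) (op_mult (confs T d) \<rho> (tensor_op T (site_log d sig z)))))"
    using T pd by (subst rel_ent_tensor_op) (auto simp: site)
  moreover have "rel_ent (confs T d) \<rho> (tensor_op T sig) = - entropy (confs T d) \<rho>
     - (\<Sum>z\<in>T. Re (op_trace (confs T d) (op_mult (confs T d) \<rho> (tensor_op T (site_log d sig z)))))"
    by (rule rel_ent_tensor_op[OF T pd])
  ultimately show ?thesis
    unfolding rel_ent_site_def red reduced_tensor_op[OF T x, of d sig, OF tr]
    by (simp add: sum.remove[OF T x])
qed

theorem mainTheorem7:
  fixes \<Lambda> :: "'s set" and d :: "'s \<Rightarrow> nat"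
    and \<rho> :: "('s \<Rightarrow> nat) op" and sig :: "'s \<Rightarrow> nat op"
  assumes "finite \<Lambda>"
    and "\<forall>x\<in>\<Lambda>. 0 < d x"
    and "is_state (confs \<Lambda> d) \<rho>"
    and "\<forall>x\<in>\<Lambda>. is_full_rank_state {..<d x} (sig x)"
  shows "rel_ent (confs \<Lambda> d) \<rho> (tensor_op \<Lambda> sig)
           \<le> (\<Sum>x\<in>\<Lambda>. rel_ent_site \<Lambda> d x \<rho> (tensor_op \<Lambda> sig))"
proof -
  define t where "t x = Re (op_trace (confs \<Lambda> d) (op_mult (confs \<Lambda> d) \<rho> (tensor_op \<Lambda> (site_log d sig x))))" for x
  have pd: "op_pd {..<d x} (sig x)" if "x \<in> \<Lambda>" for x
    using assms(4) that unfolding is_full_rank_state_def by blast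
  have "(\<Sum>x\<in>\<Lambda>. entropy (confs \<Lambda> d) \<rho> - entropy (confs (\<Lambda> - {x}) d) (reduced d \<Lambda> (\<Lambda> - {x}) \<rho>))
      \<le> entropy (confs \<Lambda> d) (reduced d \<Lambda> \<Lambda> \<rho>)"
    by (rule sum_conditional_entropy_le[OF assms(1-3) subset_refl])
  \<comment> \<open>Reducing to all sites returns \<open>\<rho>\<close> only on configurations,
    which is all the entropy depends on.\<close>
  also have "\<dots> = entropy (confs \<Lambda> d) \<rho>" by (intro entropy_cong reduced_self)
  finally have "- entropy (confs \<Lambda> d) \<rho> - (\<Sum>x\<in>\<Lambda>. t x) \<le>
      - (\<Sum>x\<in>\<Lambda>. entropy (confs \<Lambda> d) \<rho> - entropy (confs (\<Lambda> - {x}) d) (reduced d \<Lambda> (\<Lambda> - {x}) \<rho>)) - (\<Sum>x\<in>\<Lambda>. t x)"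
    by simp
  \<comment> \<open>Each site contributes its own \<open>t x\<close> exactly once, so the
    logarithmic terms add up to those of the full relative entropy.\<close>
  also have "\<dots> = (\<Sum>x\<in>\<Lambda>. rel_ent_site \<Lambda> d x \<rho> (tensor_op \<Lambda> sig))"
    unfolding sum_negf[symmetric] sum_subtractf[symmetric] t_def
    using assms(1,4) by (intro sum.cong refl) (simp add: rel_ent_site_tensor_op)
  also have "- entropy (confs \<Lambda> d) \<rho> - (\<Sum>x\<in>\<Lambda>. t x) = rel_ent (confs \<Lambda> d) \<rho> (tensor_op \<Lambda> sig)"
    unfolding t_def by (rule rel_ent_tensor_op[OF assms(1) pd, symmetric])
  finally show ?thesis .
qed

end
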